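(* Let $\Phi = (\phi_1,\dots,\phi_K) \in \mathbb{R}^{d \times K}$ be a dictionary with unit norm columns, let $H := \Phi^{\ast}\Phi - \mathbb{I}$ be its hollow Gram matrix and $\mu := \max_{i\neq j} |\langle \phi_i,\phi_j\rangle|$ its coherence. Assume that the signals $y = \Phi_I x_I$ follow the random signal model described in the context, where the support $I \subseteq \{1,\dots,K\}$ is chosen according to the rejective sampling model with probabilities $p_1,\dots,p_K$ such that $\sum_{i=1}^K p_i = S$, with strictly positive coefficient sequence $c = (c_1,\dots,c_S)$. Let $W = \operatorname{diag}(\sqrt{p_1},\dots,\sqrt{p_K})$ be the corresponding weight matrix, and let $\varepsilon\in(0,1)$. Assume that $\|WHW\|_{2,2} \leq \frac{1}{4e^2}$. If \[ \|HW\|_{\infty,2}^2 \leq \min\left\{ \min_{\emptyset\neq L \subseteq \{1,\dots,S\}} \frac{\|c_L\|_\infty^2}{16e^2\|c_L\|_2^2},\ \frac{1}{16e^2\log(218K/\varepsilon)} \right\} \] and \[ \mu \leq \min\left\{ \min_{\emptyset\neq L \subseteq \{1,\dots,S\}} \frac{\|c_L\|_\infty}{4\|c_L\|_2\sqrt{\log(218K/\varepsilon)}},\ \frac{1}{4\log(218K/\varepsilon)} \right\}, \] then Orthogonal Matching Pursuit (OMP) recovers the correct support $I$ with probability at least $1-\varepsilon$.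
   Context: Norms: $\|A\|_{2,2}$ is the operator (spectral) norm and $\|A\|_{\infty,2}$ the maximal $\ell_2$-norm of a row of $A$; $c_L$ is the restriction of $c$ to the entries indexed by $L$. $A^{\ast}$ is the transpose, $A_I$ the submatrix with columns indexed by $I$, $\mathbb{I}$ the identity matrix, and $P(A_J) = A_JA_J^{\dagger}$ (Moore–Penrose pseudoinverse) the orthogonal projection onto the column span of $A_J$. Rejective sampling model: let $p_1,\dots,p_K \in [0,1]$ with $\sum_{j} p_j = S$, $S$ a positive integer, and let $\delta_1,\dots,\delta_K$ be independent Bernoulli $0$-$1$ random variables with $\mathbb{E}\,\delta_j = p_j$. The Poisson sampling model is the law of $\{i : \delta_i = 1\}$, i.e. $\mathbb{P}(I) = \prod_{i\in I} p_i \prod_{j \notin I}(1-p_j)$. The rejective sampling model is this law conditioned on $|I| = S$, i.e. $\mathbb{P}_S(I) := \mathbb{P}(I \mid |I| = S)$. Signal model: $y = \Phi_I x_I = \sum_{k=1}^S \phi_{i_k} x_{i_k}$ with $x_{i_k} = c_k\sigma_k$ for $k = 1,\dots,S$, where $I = \{i_1,\dots,i_S\}$ is the random support drawn from the rejective sampling model, $c = (c_1,\dots,c_S)$ is an arbitrary fixed sequence of strictly positive coefficients, and $\sigma_1,\dots,\sigma_S$ are independent Rademacher signs ($\pm1$ with equal probability), independent of $I$. OMP: initialise $r_0 = y$, $J_0 = \emptyset$; in step $i$ choose $j \in \operatorname{argmax}_k |\langle \phi_k, r_i\rangle|$, set $J_{i+1} = J_i\cup\{j\}$ and $r_{i+1}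 = y - P(\Phi_{J_{i+1}})y$. OMP recovers the support if it picks an index of $I$ not yet selected in each of the first $S$ steps, so that $J_S = I$. *)

theory Defs
  imports "HOL-Probability.Probability"
begin

text \<open>
  A dictionary of \<open>K\<close> atoms in \<open>d\<close>-dimensional space is a matrix \<open>\<Phi> :: real ^ 'k ^ 'd\<close>, with
  \<open>K = CARD('k)\<close>, \<open>d = CARD('d)\<close> and atoms \<open>column k \<Phi>\<close>.
\<close>

section \<open>Matrices and norms\<close>

definition hollow_gram :: "real ^ 'k ^ 'd \<Rightarrow> real ^ 'k ^ 'k" where
  "hollow_gram \<Phi> = transpose \<Phi> ** \<Phi> - mat 1"

text \<open>The inserted \<open>0\<close> only matters for a single atom, where the maximum would be over the empty set.\<close>

definition coherence :: "real ^ 'k ^ 'd \<Rightarrow> real" where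
  "coherence \<Phi> = Max (insert 0 {\<bar>column i \<Phi> \<bullet> column j \<Phi>\<bar> | i j. i \<noteq> j})"

definition weight_matrix :: "('k \<Rightarrow> real) \<Rightarrow> real ^ 'k ^ 'k" where
  "weight_matrix p = (\<chi> i j. if i = j then sqrt (p i) else 0)"

definition norm_2_2 :: "real ^ 'n ^ 'm \<Rightarrow> real" where
  "norm_2_2 A = onorm (\<lambda>x. A *v x)"

definition norm_inf_2 :: "real ^ 'n ^ 'm \<Rightarrow> real" where
  "norm_inf_2 A = (MAX i. norm (row i A))"

text \<open>Norms of the restriction of a coefficient sequence to a finite nonempty index set;
  the \<open>\<ell>\<^sub>2\<close>-norm of the restriction is \<^const>\<open>L2_set\<close>.\<close>

definition Linf_set :: "(nat \<Rightarrow> real) \<Rightarrow> nat set \<Rightarrow> real" where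
  "Linf_set c L = (MAX k\<in>L. \<bar>c k\<bar>)"


section \<open>Pseudoinverse and projection\<close>

definition is_pinv :: "real ^ 'n ^ 'm \<Rightarrow> real ^ 'm ^ 'n \<Rightarrow> bool" where
  "is_pinv A X \<longleftrightarrow> A ** X ** A = A \<and> X ** A ** X = X \<and>
     transpose (A ** X) = A ** X \<and> transpose (X ** A) = X ** A"

definition pinv :: "real ^ 'n ^ 'm \<Rightarrow> real ^ 'm ^ 'n" where
  "pinv A = (THE X. is_pinv A X)"

text \<open>
  The submatrix with columns indexed by \<open>J\<close> is represented by setting all other columns to zero.
  This changes neither the column span nor \<open>A\<^sub>J A\<^sub>J\<^sup>\<dagger>\<close>, as the pseudoinverse is padded
  by zero rows.
\<close>

definition submat_cols :: "real ^ 'n ^ 'm \<Rightarrow> 'n set \<Rightarrow> real ^ 'n ^ 'm" where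
  "submat_cols A J = (\<chi> i j. if j \<in> J then A $ i $ j else 0)"

definition proj_mat :: "real ^ 'n ^ 'm \<Rightarrow> real ^ 'm ^ 'm" where
  "proj_mat A = A ** pinv A"

lemma is_pinv_unique:
  assumes X: "is_pinv A X" and Y: "is_pinv A Y"
  shows "X = Y"
proof -
  have AX: "A ** X = A ** Y"
  proof -
    have "A ** X = transpose (A ** Y ** (A ** X))"
      using X Y by (simp add: is_pinv_def matrix_mul_assoc)
    also have "\<dots> = transpose (A ** X) ** transpose (A ** Y)"
      by (rule matrix_transpose_mul)
    also have "\<dots> = A ** Y"
      using X Y by (simp add: is_pinv_def matrix_mul_assoc)
    finally show ?thesis .
  qed
  have XA: "X ** A = Y ** A"
  proof -
    have "X ** A = transpose (X ** A ** (Y ** A))"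
      using X Y by (simp add: is_pinv_def flip: matrix_mul_assoc)
    also have "\<dots> = transpose (Y ** A) ** transpose (X ** A)"
      by (rule matrix_transpose_mul)
    also have "\<dots> = Y ** A"
      using X Y by (simp add: is_pinv_def flip: matrix_mul_assoc)
    finally show ?thesis .
  qed
  have "X = X ** A ** X" using X by (simp add: is_pinv_def)
  also have "\<dots> = Y ** A ** X" by (simp add: XA)
  also have "\<dots> = Y ** A ** Y" by (simp add: AX flip: matrix_mul_assoc)
  also have "\<dots> = Y" using Y by (simp add: is_pinv_def)
  finally show ?thesis .
qed

lemma ex_projection_matrix:
  fixes U :: "(real ^ 'n) set"
  assumes "subspace U"
  obtains Q where "transpose Q = Q" "\<And>x. Q *v x \<in> U" "\<And>x. x \<in> U \<Longrightarrow> Q *v x = x"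
proof -
  obtain B where B: "B \<subseteq> U" "pairwise orthogonal B" "\<And>x. x \<in> B \<Longrightarrow> norm x = 1"
      "independent B" "card B = dim U" "span B = U"
    using orthonormal_basis_subspace[OF assms] by metis
  have fin: "finite B" using B(4) by (rule independent_imp_finite)
  define Q :: "real^'n^'n" where "Q = (\<chi> i j. \<Sum>b\<in>B. b $ i * b $ j)"
  have Q: "Q *v x = (\<Sum>b\<in>B. (b \<bullet> x) *\<^sub>R b)" for x
    unfolding Q_def matrix_vector_mult_def vec_eq_iff
    by (simp add: inner_vec_def sum_distrib_left sum_distrib_right sum.swap[of _ _ B] mult_ac)
  have QB: "Q *v b = b" if "b \<in> B" for b
  proof -
    have "(\<Sum>a\<in>B. (a \<bullet> b) *\<^sub>R a) = (\<Sum>a\<in>B. if a = b then b else 0)"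
    proof (rule sum.cong[OF refl])
      fix a assume "a \<in> B"
      then show "(a \<bullet> b) *\<^sub>R a = (if a = b then b else 0)"
        using B(2,3) that by (auto simp: pairwise_def orthogonal_def dot_square_norm)
    qed
    then show ?thesis using fin that by (simp add: Q)
  qed
  show thesis
  proof
    show "transpose Q = Q" by (simp add: Q_def transpose_def vec_eq_iff mult.commute)
    show "Q *v x \<in> U" for x
      unfolding Q using B(1) assms by (intro subspace_sum subspace_scale) auto
    show "Q *v x = x" if "x \<in> U" for x
    proof -
      have "x \<in> span B" using B(6) that by simp
      then show ?thesis
        by (induction rule: span_induct_alt)
          (auto simp: matrix_vector_right_distrib matrix_vector_mult_scaleR QB)
    qed
  qed
qed

lemma ex_is_pinv:
  fixes A :: "real ^ 'n ^ 'm"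
  shows "\<exists>X. is_pinv A X"
proof -
  let ?f = "\<lambda>x. A *v x"
  define U where "U = range ?f"
  define V where "V = span (rows A)"
  have U: "subspace U"
    unfolding U_def by (intro linear_subspace_image matrix_vector_mul_linear) simp
  have V: "subspace V" by (simp add: V_def)
  obtain P where P: "transpose P = P" "\<And>x. P *v x \<in> U" "\<And>x. x \<in> U \<Longrightarrow> P *v x = x"
    using ex_projection_matrix[OF U] by metis
  obtain Q where Q: "transpose Q = Q" "\<And>x. Q *v x \<in> V" "\<And>x. x \<in> V \<Longrightarrow> Q *v x = x"
    using ex_projection_matrix[OF V] by metis
  have orth: "w \<bullet> (x - Q *v x) = 0" if "w \<in> V" for w x
    using Q(1) Q(3)[OF that]
    by (metis (no_types) inner_diff_right dot_lmul_matrix vector_transpose_matrix right_minus_eq)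
  have fQ: "A *v (Q *v x) = A *v x" for x
  proof -
    have "row i A \<bullet> (x - Q *v x) = 0" for i
      by (rule orth) (auto simp: V_def rows_def intro: span_base)
    then have "A *v (x - Q *v x) = 0"
      by (simp add: vec_eq_iff matrix_vector_mul_component row_def inner_vec_def
          matrix_vector_mult_def)
    then show ?thesis by (simp add: matrix_vector_mult_diff_distrib)
  qed
  have inj: "inj_on ?f V"
  proof (rule inj_onI)
    fix x y assume xy: "x \<in> V" "y \<in> V" "A *v x = A *v y"
    have "x - y \<in> span (rows A)" using xy V by (simp add: V_def span_diff)
    moreover have "A *v (x - y) = 0" using xy(3) by (simp add: matrix_vector_mult_diff_distrib)
    ultimately have "orthogonal (x - y) (x - y)"
      using orthogonal_nullspace_rowspace by blast
    then show "x = y" by (simp add: orthogonal_self)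
  qed
  obtain g where g: "range g \<subseteq> V" "linear g" "\<forall>v\<in>V. g (A *v v) = v"
    using linear_exists_left_inverse_on[OF matrix_vector_mul_linear V inj] by blast
  define X where "X = matrix g ** P"
  have X: "X *v y = g (P *v y)" for y
    by (simp add: X_def g(2) flip: matrix_vector_mul_assoc)
  have fg: "A *v g u = u" if u: "u \<in> U" for u
  proof -
    obtain x where "u = A *v x" using u unfolding U_def by blast
    then have "u = A *v (Q *v x)" by (simp only: fQ)
    then show ?thesis using g(3) Q(2) by simp
  qed
  have AX: "A ** X = P"
    by (simp add: matrix_eq X fg P(2) flip: matrix_vector_mul_assoc)
  have XA: "X ** A = Q"
  proof -
    have "g (P *v (A *v x)) = Q *v x" for x
      using P(3)[of "A *v x"] g(3) Q(2) fQ[of x] by (metis U_def rangeI)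
    then show ?thesis by (simp add: matrix_eq X flip: matrix_vector_mul_assoc)
  qed
  have "P ** A = A"
    using P(3) by (simp add: matrix_eq U_def flip: matrix_vector_mul_assoc)
  moreover have "Q ** X = X"
    using Q(3) g(1) by (simp add: matrix_eq X image_subset_iff flip: matrix_vector_mul_assoc)
  ultimately have "is_pinv A X" by (simp add: is_pinv_def AX XA P(1) Q(1))
  then show ?thesis ..
qed

lemma is_pinv_pinv: "is_pinv A (pinv A)"
  unfolding pinv_def by (rule theI') (use ex_is_pinv is_pinv_unique in blast)

lemma span_columns_submat_cols:
  "span (columns (submat_cols A J)) = span ((\<lambda>j. column j A) ` J)"
proof -
  have col: "column j (submat_cols A J) = (if j \<in> J then column j A else 0)" for j
    by (simp add: column_def submat_cols_def vec_eq_iff)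
  have "columns (submat_cols A J) \<subseteq> span ((\<lambda>j. column j A) ` J)"
    by (auto simp: columns_def col span_zero intro: span_base)
  moreover have "column j A \<in> columns (submat_cols A J)" if "j \<in> J" for j
  proof -
    have "column j (submat_cols A J) \<in> columns (submat_cols A J)"
      unfolding columns_def by blast
    then show ?thesis by (simp add: col that)
  qed
  then have "(\<lambda>j. column j A) ` J \<subseteq> span (columns (submat_cols A J))"
    by (auto intro: span_base)
  ultimately show ?thesis
    by (intro antisym span_minimal) auto
qed

lemma proj_mat_in_span: "proj_mat A *v y \<in> span (columns A)"
  unfolding proj_mat_def
  by (simp add: matrix_vector_mult_in_columnspace flip: matrix_vector_mul_assoc)

lemma proj_mat_residual_orthogonal:
  assumes "v \<in> span (columns A)"
  shows "v \<bullet> (y - proj_mat A *v y) = 0"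
  using assms
proof (induction rule: span_induct)
  case base
  show ?case by (auto simp: subspace_def inner_add_left)
next
  case (step v)
  then obtain j where v: "v = A *v axis j 1"
    by (auto simp: columns_def matrix_vector_mult_basis)
  have "proj_mat A *v v = v"
    using is_pinv_pinv[of A] by (simp add: v proj_mat_def is_pinv_def matrix_vector_mul_assoc)
  moreover have "transpose (proj_mat A) = proj_mat A"
    using is_pinv_pinv[of A] by (simp add: proj_mat_def is_pinv_def)
  ultimately show ?case
    by (metis (no_types) inner_diff_right dot_lmul_matrix vector_transpose_matrix right_minus_eq)
qed


section \<open>Random signal model\<close>

definition poisson_sampling :: "('k::finite \<Rightarrow> real) \<Rightarrow> 'k set pmf" where
  "poisson_sampling p =
     map_pmf (\<lambda>\<delta>. {i. \<delta> i}) (Pi_pmf UNIV False (\<lambda>i. bernoulli_pmf (p i)))"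

definition rejective_sampling :: "('k::finite \<Rightarrow> real) \<Rightarrow> nat \<Rightarrow> 'k set pmf" where
  "rejective_sampling p S = cond_pmf (poisson_sampling p) {I. card I = S}"

lemma pmf_poisson_sampling:
  fixes p :: "'k::finite \<Rightarrow> real"
  assumes "\<And>i. 0 \<le> p i" "\<And>i. p i \<le> 1"
  shows "pmf (poisson_sampling p) I = (\<Prod>i\<in>I. p i) * (\<Prod>i\<in>-I. 1 - p i)"
proof -
  have inj: "inj (\<lambda>\<delta>::'k \<Rightarrow> bool. {i. \<delta> i})" by (auto simp: inj_def)
  have "pmf (poisson_sampling p) {i. i \<in> I} =
      (\<Prod>i\<in>UNIV. pmf (bernoulli_pmf (p i)) (i \<in> I))"
    unfolding poisson_sampling_def
    using pmf_map_inj'[OF inj, of _ "\<lambda>i. i \<in> I"] by (simp add: pmf_Pi)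
  also have "\<dots> = (\<Prod>i\<in>I \<union> -I. if i \<in> I then p i else 1 - p i)"
    using assms by (intro prod.cong) auto
  also have "\<dots> = (\<Prod>i\<in>I. p i) * (\<Prod>i\<in>-I. 1 - p i)"
    by (subst prod.union_disjoint) auto
  finally show ?thesis by simp
qed

lemma poisson_sampling_card_possible:
  fixes p :: "'k::finite \<Rightarrow> real"
  assumes p: "\<And>i. 0 \<le> p i" "\<And>i. p i \<le> 1" and S: "(\<Sum>i\<in>UNIV. p i) = real S"
  shows "set_pmf (poisson_sampling p) \<inter> {I. card I = S} \<noteq> {}"
proof -
  let ?A = "{i. p i = 1}" and ?B = "{i. p i > 0}"
  have "real (card ?A) = (\<Sum>i\<in>?A. p i)" by simp
  also have "\<dots> \<le> real S" unfolding S[symmetric] using p by (intro sum_mono2) auto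
  finally have 1: "card ?A \<le> S" by simp
  have "real S = (\<Sum>i\<in>?B. p i)"
    unfolding S[symmetric] using p by (intro sum.mono_neutral_right) (auto simp: order.antisym)
  also have "\<dots> \<le> (\<Sum>i\<in>?B. 1)" using p by (intro sum_mono) auto
  finally have 2: "S \<le> card ?B" by simp
  have "?A \<subseteq> ?B" by auto
  then obtain I where I: "?A \<subseteq> I" "I \<subseteq> ?B" "card I = S"
    using exists_subset_between[OF 1 2] by auto
  have "pmf (poisson_sampling p) I > 0"
    unfolding pmf_poisson_sampling[OF p] using I p
    by (intro mult_pos_pos prod_pos) (auto simp: less_le)
  then have "I \<in> set_pmf (poisson_sampling p)" by (simp add: set_pmf_iff)
  then show ?thesis using I(3) by blast
qed

definition rademacher_signs :: "nat \<Rightarrow> (nat \<Rightarrow> real) pmf" where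
  "rademacher_signs S = Pi_pmf {1..S} 0 (\<lambda>_. pmf_of_set {-1, 1})"

text \<open>\<open>e I\<close> is the enumeration \<open>i\<^sub>1, \<dots>, i\<^sub>S\<close> of the support \<open>I\<close>.\<close>

definition signal ::
  "real ^ 'k ^ 'd \<Rightarrow> nat \<Rightarrow> (nat \<Rightarrow> real) \<Rightarrow> ('k set \<Rightarrow> nat \<Rightarrow> 'k) \<Rightarrow> 'k set \<Rightarrow> (nat \<Rightarrow> real) \<Rightarrow> real ^ 'd"
  where "signal \<Phi> S c e I \<sigma> = (\<Sum>k=1..S. (c k * \<sigma> k) *\<^sub>R column (e I k) \<Phi>)"


section \<open>Orthogonal Matching Pursuit\<close>

text \<open>In step \<open>i\<close> the run selects \<open>j i\<close>, given the current index set \<open>J i\<close> and residual \<open>r i\<close>.\<close>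

definition omp_run ::
  "real ^ 'k ^ 'd \<Rightarrow> real ^ 'd \<Rightarrow> (nat \<Rightarrow> 'k) \<Rightarrow> (nat \<Rightarrow> 'k set) \<Rightarrow> (nat \<Rightarrow> real ^ 'd) \<Rightarrow> bool"
  where "omp_run \<Phi> y j J r \<longleftrightarrow>
     r 0 = y \<and> J 0 = {} \<and>
     (\<forall>i. is_arg_max (\<lambda>k. \<bar>column k \<Phi> \<bullet> r i\<bar>) (\<lambda>_. True) (j i) \<and>
          J (Suc i) = J i \<union> {j i} \<and>
          r (Suc i) = y - proj_mat (submat_cols \<Phi> (J (Suc i))) *v y)"

text \<open>Recovery is required however ties in the argmax are broken.\<close>

definition omp_recovers :: "real ^ 'k ^ 'd \<Rightarrow> real ^ 'd \<Rightarrow> nat \<Rightarrow> 'k set \<Rightarrow> bool" where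
  "omp_recovers \<Phi> y S I \<longleftrightarrow>
     (\<forall>j J r. omp_run \<Phi> y j J r \<longrightarrow> (\<forall>i<S. j i \<in> I - J i) \<and> J S = I)"

lemma omp_run_exists: "\<exists>j J r. omp_run \<Phi> y j J r"
proof -
  define sel where "sel x = (SOME k. is_arg_max (\<lambda>k. \<bar>column k \<Phi> \<bullet> x\<bar>) (\<lambda>_. True) k)" for x
  have sel: "is_arg_max (\<lambda>k. \<bar>column k \<Phi> \<bullet> x\<bar>) (\<lambda>_. True) (sel x)" for x
  proof -
    obtain k where "\<And>l. \<bar>column l \<Phi> \<bullet> x\<bar> \<le> \<bar>column k \<Phi> \<bullet> x\<bar>"
    proof -
      let ?F = "range (\<lambda>k. \<bar>column k \<Phi> \<bullet> x\<bar>)"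
      have "Max ?F \<in> ?F" by (rule Max_in) auto
      then obtain k where "Max ?F = \<bar>column k \<Phi> \<bullet> x\<bar>" by blast
      then show thesis using that by (metis Max_ge finite finite_imageI rangeI)
    qed
    then have "is_arg_max (\<lambda>k. \<bar>column k \<Phi> \<bullet> x\<bar>) (\<lambda>_. True) k"
      by (simp add: is_arg_max_def not_less)
    then show ?thesis unfolding sel_def by (rule someI)
  qed
  define step where "step = (\<lambda>(J, x). let J' = J \<union> {sel x} in
      (J', y - proj_mat (submat_cols \<Phi> J') *v y))"
  define st where "st n = (step ^^ n) ({}, y)" for n
  have "omp_run \<Phi> y (\<lambda>i. sel (snd (st i))) (\<lambda>i. fst (st i)) (\<lambda>i. snd (st i))"
    by (auto simp: omp_run_def sel st_def step_def Let_def case_prod_beta)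
  then show ?thesis by blast
qed

end

theory Submission
  imports Defs
begin

text \<open>
  The signs of the signal play no role: OMP succeeds deterministically as soon as
  \<open>\<parallel>H\<^bsub>I,I\<^esub>\<parallel> < 4/5\<close> and every row of \<open>H\<close>, restricted to \<open>I\<close>, has squared norm below
  \<open>t = min\<^sub>L \<parallel>c\<^sub>L\<parallel>\<^sub>\<infinity>\<^sup>2 / (16 \<parallel>c\<^sub>L\<parallel>\<^sub>2\<^sup>2)\<close>. Both conditions fail only on increasing families of supports,
  for which rejective sampling is dominated by 8 times Poisson sampling. The norm of \<open>H\<^bsub>I,I\<^esub>\<close> is
  decoupled by a random cut of the index set; an off-diagonal block is then a sum of independent
  rank-one matrices given one side of the cut, and three applications of a matrix Chernoff
  inequality (to single rows, to \<open>W H R\<close>, and to the block itself) bound it.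

  The matrix Chernoff inequality is proved for sums \<open>Z = \<Sum>\<^sub>j \<delta>\<^sub>j h\<^sub>j h\<^sub>j\<^sup>*\<close> by trace moments, without
  trace inequalities for matrix exponentials: as \<open>(h \<cdot> Z\<^sup>a h) (h \<cdot> Z\<^sup>b h) \<le> |h|\<^sup>2 (h \<cdot> Z\<^sup>a\<^sup>+\<^sup>b h)\<close>, a rank-one
  update expands as if it commuted with \<open>Z\<close>, and the moments \<open>E tr Z\<^sup>m\<close> satisfy the recursion of
  the moments of a scaled Poisson variable.
\<close>

section \<open>Poisson sampling\<close>

text \<open>Independent selection from a ground set \<open>A\<close>, kept as a finite weighted sum
  instead of a pmf: this permits induction on \<open>A\<close> and conditioning on one side of a
  cut.\<close>

definition poisson_weight :: "('i \<Rightarrow> real) \<Rightarrow> 'i set \<Rightarrow> 'i set \<Rightarrow> real" where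
  "poisson_weight p A I = (\<Prod>i\<in>I. p i) * (\<Prod>i\<in>A - I. 1 - p i)"

definition poisson_mean :: "('i \<Rightarrow> real) \<Rightarrow> 'i set \<Rightarrow> ('i set \<Rightarrow> real) \<Rightarrow> real" where
  "poisson_mean p A g = (\<Sum>I\<in>Pow A. poisson_weight p A I * g I)"

lemma poisson_mean_empty [simp]: "poisson_mean p {} g = g {}"
  by (simp add: poisson_mean_def poisson_weight_def)

lemma poisson_mean_insert:
  assumes "finite A" "a \<notin> A"
  shows "poisson_mean p (insert a A) g =
    p a * poisson_mean p A (\<lambda>I. g (insert a I)) + (1 - p a) * poisson_mean p A g"
proof -
  have inj: "inj_on (insert a) (Pow A)"
    using assms by (intro inj_onI) (metis PowD insert_ident subsetD)
  have fin: "finite I" if "I \<subseteq> A" for I using that assms finite_subset by blast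
  have w1: "poisson_weight p (insert a A) (insert a I) = p a * poisson_weight p A I" if "I \<subseteq> A" for I
  proof -
    have "insert a A - insert a I = A - I" "a \<notin> I" using assms that by auto
    then show ?thesis using fin[OF that] by (simp add: poisson_weight_def)
  qed
  have w2: "poisson_weight p (insert a A) I = (1 - p a) * poisson_weight p A I" if "I \<subseteq> A" for I
  proof -
    have "insert a A - I = insert a (A - I)" using assms that by auto
    then show ?thesis using assms by (simp add: poisson_weight_def)
  qed
  have "poisson_mean p (insert a A) g =
      (\<Sum>I\<in>Pow A. poisson_weight p (insert a A) I * g I) +
      (\<Sum>I\<in>insert a ` Pow A. poisson_weight p (insert a A) I * g I)"
    unfolding poisson_mean_def Pow_insert using assms by (intro sum.union_disjoint) auto
  also have "(\<Sum>I\<in>insert a ` Pow A. poisson_weight p (insert a A) I * g I) =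
      (\<Sum>I\<in>Pow A. p a * (poisson_weight p A I * g (insert a I)))"
    unfolding sum.reindex[OF inj] by (intro sum.cong) (auto simp: w1)
  also have "(\<Sum>I\<in>Pow A. poisson_weight p (insert a A) I * g I) =
      (\<Sum>I\<in>Pow A. (1 - p a) * (poisson_weight p A I * g I))"
    by (intro sum.cong) (auto simp: w2)
  finally show ?thesis
    by (simp add: poisson_mean_def sum_distrib_left)
qed

lemma poisson_mean_cong:
  "(\<And>I. I \<subseteq> A \<Longrightarrow> f I = g I) \<Longrightarrow> poisson_mean p A f = poisson_mean p A g"
  unfolding poisson_mean_def by (intro sum.cong) auto

lemma poisson_mean_add:
  "poisson_mean p A (\<lambda>I. f I + g I) = poisson_mean p A f + poisson_mean p A g"
  by (simp add: poisson_mean_def distrib_left sum.distrib)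

lemma poisson_mean_cmult: "poisson_mean p A (\<lambda>I. a * f I) = a * poisson_mean p A f"
  by (simp add: poisson_mean_def sum_distrib_left mult_ac)

lemma poisson_mean_sum:
  "poisson_mean p A (\<lambda>I. \<Sum>x\<in>X. f x I) = (\<Sum>x\<in>X. poisson_mean p A (f x))"
  unfolding poisson_mean_def by (simp add: sum_distrib_left sum.swap[of _ X])

lemma poisson_mean_const:
  assumes "finite A" shows "poisson_mean p A (\<lambda>_. a) = a"
  using assms by induction (simp_all add: poisson_mean_insert algebra_simps)

text \<open>Independence over disjoint ground sets. With \<open>A = -T\<close> and
  \<open>B = T\<close> it conditions on the part of the sample outside a cut.\<close>

lemma poisson_mean_union:
  assumes "finite A" "finite B" "A \<inter> B = {}"
  shows "poisson_mean p (A \<union> B) g = poisson_mean p A (\<lambda>I. poisson_mean p B (\<lambda>J. g (I \<union> J)))"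
  using assms
proof (induction A arbitrary: g)
  case (insert a A)
  have "poisson_mean p (insert a A \<union> B) g =
      p a * poisson_mean p (A \<union> B) (\<lambda>I. g (insert a I)) + (1 - p a) * poisson_mean p (A \<union> B) g"
    using insert by (simp add: poisson_mean_insert)
  then show ?case using insert by (simp add: poisson_mean_insert)
qed simp

text \<open>Conditioning on the choice of \<open>j\<close>. On the right \<open>I\<close> again runs
  over subsets of all of \<open>A\<close>, since \<open>insert j\<close> forgets whether
  \<open>j\<close> was drawn; this lets the moment recursion close up.\<close>

lemma poisson_mean_member:
  assumes "finite A" "j \<in> A"
  shows "poisson_mean p A (\<lambda>I. of_bool (j \<in> I) * g I) = p j * poisson_mean p A (\<lambda>I. g (insert j I))"
proof -
  define B where "B = A - {j}"
  have A: "A = insert j B" "finite B" "j \<notin> B" using assms by (auto simp: B_def)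
  have 0: "poisson_mean p B (\<lambda>I. of_bool (j \<in> I) * g I) = poisson_mean p B (\<lambda>I. 0)"
    by (rule poisson_mean_cong) (use A in auto)
  show ?thesis
    unfolding A(1) poisson_mean_insert[OF A(2,3)] 0
    using A by (simp add: poisson_mean_const algebra_simps)
qed

lemma poisson_weight_nonneg:
  assumes "\<And>i. p i \<in> {0..1}"
  shows "0 \<le> poisson_weight p A I"
  unfolding poisson_weight_def using assms by (auto intro!: mult_nonneg_nonneg prod_nonneg)

lemma poisson_mean_mono:
  assumes "\<And>i. p i \<in> {0..1}" "\<And>I. I \<subseteq> A \<Longrightarrow> f I \<le> g I"
  shows "poisson_mean p A f \<le> poisson_mean p A g"
  unfolding poisson_mean_def using assms
  by (intro sum_mono mult_left_mono poisson_weight_nonneg) auto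

lemma poisson_mean_nonneg:
  assumes "\<And>i. p i \<in> {0..1}" "\<And>I. I \<subseteq> A \<Longrightarrow> 0 \<le> f I"
  shows "0 \<le> poisson_mean p A f"
  unfolding poisson_mean_def using assms
  by (intro sum_nonneg mult_nonneg_nonneg poisson_weight_nonneg) auto

section \<open>A matrix Chernoff inequality\<close>

text \<open>Cross-multiplied form of the monotonicity of the ratios s(n+1)/s(n), so that zero terms
  are allowed; a nonzero middle term is cancelled in the induction step.\<close>

lemma log_convex_ratio_mono:
  fixes s :: "nat \<Rightarrow> real"
  assumes nonneg: "\<And>n. 0 \<le> s n" and conv: "\<And>n. (s (Suc n))\<^sup>2 \<le> s n * s (Suc (Suc n))"
    and "a \<le> b"
  shows "s (Suc a) * s b \<le> s a * s (Suc b)"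
  using \<open>a \<le> b\<close>
proof (induction b rule: dec_induct)
  case (step b)
  show ?case
  proof (cases "s (Suc b) = 0")
    case False
    then have pos: "0 < s (Suc b)" using nonneg by (simp add: order.not_eq_order_implies_strict)
    have "s (Suc a) * s (Suc b) * s (Suc b) \<le> s (Suc a) * (s b * s (Suc (Suc b)))"
      using mult_left_mono[OF conv nonneg] by (simp add: power2_eq_square mult.assoc)
    also have "\<dots> \<le> s a * s (Suc (Suc b)) * s (Suc b)"
      using mult_right_mono[OF step.IH nonneg[of "Suc (Suc b)"]] by (simp add: mult_ac)
    finally show ?thesis using pos by simp
  qed (simp add: nonneg)
qed simp

text \<open>Shifting one unit from the smaller index to the larger never decreases the product, so
  the split into \<open>0\<close> and \<open>a + b\<close> is extremal.\<close>

lemma log_convex_mult_le: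
  fixes s :: "nat \<Rightarrow> real"
  assumes nonneg: "\<And>n. 0 \<le> s n" and conv: "\<And>n. (s (Suc n))\<^sup>2 \<le> s n * s (Suc (Suc n))"
  shows "s a * s b \<le> s 0 * s (a + b)"
proof -
  have *: "s a * s b \<le> s 0 * s (a + b)" if "a \<le> b" for a b
    using that
  proof (induction a arbitrary: b)
    case (Suc a)
    have "s (Suc a) * s b \<le> s a * s (Suc b)"
      using Suc.prems by (intro log_convex_ratio_mono assms) simp
    also have "\<dots> \<le> s 0 * s (Suc a + b)" using Suc.IH[of "Suc b"] Suc.prems by simp
    finally show ?case .
  qed simp
  show ?thesis using *[of a b] *[of b a] by (cases "a \<le> b") (auto simp: mult_ac add_ac)
qed

section \<open>Quadratic forms of powers of a sum of rank-one operators\<close>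

text \<open>Defined on any Euclidean space: the instance \<open>real\<close> turns the matrix tail
  bound into the scalar one used for single rows.\<close>

definition frame_op :: "('i \<Rightarrow> 'a::euclidean_space) \<Rightarrow> 'i set \<Rightarrow> 'a \<Rightarrow> 'a" where
  "frame_op h I v = (\<Sum>i\<in>I. (h i \<bullet> v) *\<^sub>R h i)"

definition trace_pow :: "('i \<Rightarrow> 'a::euclidean_space) \<Rightarrow> 'i set \<Rightarrow> nat \<Rightarrow> real" where
  "trace_pow h I m = (\<Sum>b\<in>Basis. b \<bullet> (frame_op h I ^^ m) b)"

lemma linear_frame_op: "linear (frame_op h I)"
  by (rule linearI)
    (simp_all add: frame_op_def inner_add_right scaleR_add_left sum.distrib scaleR_right.sum)

lemma linear_frame_op_pow: "linear (frame_op h I ^^ m)"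
proof (induction m)
  case (Suc m)
  then show ?case using linear_compose[OF Suc linear_frame_op] by (simp add: comp_def)
qed (simp add: linear_id[unfolded id_def])

lemma frame_op_sym: "x \<bullet> frame_op h I y = frame_op h I x \<bullet> y"
  by (simp add: frame_op_def inner_sum_left inner_sum_right inner_commute mult_ac)

text \<open>Gram vectors are indexed by a basis for \<open>m = 0\<close> and by \<open>I\<close> for
  \<open>m = 1\<close>; renumbering gives one index type for all \<open>m\<close>.\<close>

lemma sum_finite_reindex_nat:
  assumes "finite B"
  obtains N :: nat and \<beta> where "\<And>F::_ \<Rightarrow> real. (\<Sum>b\<in>B. F b) = (\<Sum>n<N. F (\<beta> n))"
proof -
  obtain \<beta> where "bij_betw \<beta> {0..<card B} B" using ex_bij_betw_nat_finite[OF assms] by blast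
  then have "(\<Sum>b\<in>B. F b) = (\<Sum>n<card B. F (\<beta> n))" for F :: "_ \<Rightarrow> real"
    by (simp add: sum.reindex_bij_betw atLeast0LessThan)
  then show thesis by (rule that)
qed

text \<open>A Gram representation of \<open>Z\<^sup>m\<close>, which replaces its positive semidefinite square root
  and avoids the spectral theorem.\<close>

lemma frame_op_pow_gram:
  assumes "finite I"
  shows "\<exists>(N::nat) g. \<forall>x y. x \<bullet> (frame_op h I ^^ m) y = (\<Sum>n<N. (g n \<bullet> x) * (g n \<bullet> y))"
proof (induction m rule: induct_nat_012)
  case 0
  obtain N :: nat and \<beta> :: "nat \<Rightarrow> 'b" where \<beta>: "\<And>F::'b \<Rightarrow> real. (\<Sum>b\<in>Basis. F b) = (\<Sum>n<N. F (\<beta> n))"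
    using sum_finite_reindex_nat[OF finite_Basis] by blast
  have "x \<bullet> y = (\<Sum>n<N. (\<beta> n \<bullet> x) * (\<beta> n \<bullet> y))" for x y
    unfolding \<beta>[of "\<lambda>b. (b \<bullet> x) * (b \<bullet> y)", symmetric] euclidean_inner[of x y]
    by (simp only: inner_commute)
  then show ?case by (intro exI[of _ N] exI[of _ \<beta>] allI) (unfold funpow_0)
next
  case 1
  obtain N :: nat and \<beta> :: "nat \<Rightarrow> 'a" where \<beta>: "\<And>F::'a \<Rightarrow> real. (\<Sum>b\<in>I. F b) = (\<Sum>n<N. F (\<beta> n))"
    using sum_finite_reindex_nat[OF assms] by blast
  have "x \<bullet> frame_op h I y = (\<Sum>n<N. (h (\<beta> n) \<bullet> x) * (h (\<beta> n) \<bullet> y))" for x y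
    unfolding \<beta>[of "\<lambda>i. (h i \<bullet> x) * (h i \<bullet> y)", symmetric]
    by (simp add: frame_op_def inner_sum_right inner_commute[of x] mult.commute[of "_ \<bullet> y"])
  then show ?case
    by (intro exI[of _ N] exI[of _ "\<lambda>n. h (\<beta> n)"] allI) (unfold funpow.simps One_nat_def comp_id)
next
  \<comment> \<open>Z^(m+2) = Z Z^m Z with Z symmetric, so applying Z to the Gram vectors of Z^m
    yields those of Z^(m+2).\<close>
  case (ge2 m)
  then obtain N :: nat and g
    where g: "\<And>x y. x \<bullet> (frame_op h I ^^ m) y = (\<Sum>n<N. (g n \<bullet> x) * (g n \<bullet> y))" by blast
  have "x \<bullet> (frame_op h I ^^ Suc (Suc m)) y =
      (\<Sum>n<N. (frame_op h I (g n) \<bullet> x) * (frame_op h I (g n) \<bullet> y))" for x y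
  proof -
    have "(frame_op h I ^^ Suc (Suc m)) y = frame_op h I ((frame_op h I ^^ m) (frame_op h I y))"
      by (simp add: funpow_swap1)
    then have "x \<bullet> (frame_op h I ^^ Suc (Suc m)) y =
        frame_op h I x \<bullet> (frame_op h I ^^ m) (frame_op h I y)"
      by (simp only: frame_op_sym)
    then show ?thesis by (simp only: g frame_op_sym)
  qed
  then show ?case
    by (intro exI[of _ N] exI[of _ "\<lambda>n. frame_op h I (g n)"] allI)
qed

lemma frame_op_pow_nonneg:
  assumes "finite I" shows "0 \<le> x \<bullet> (frame_op h I ^^ m) x"
proof -
  obtain N :: nat and g
    where g: "\<And>x y. x \<bullet> (frame_op h I ^^ m) y = (\<Sum>n<N. (g n \<bullet> x) * (g n \<bullet> y))"
    using frame_op_pow_gram[OF assms, of m h] by blast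
  show ?thesis by (subst g) (simp add: sum_nonneg)
qed

text \<open>Cauchy-Schwarz in the Gram representation of Z^m, applied to the coordinates of x and of
  Z x.\<close>

lemma frame_op_pow_log_convex:
  assumes "finite I"
  shows "(x \<bullet> (frame_op h I ^^ Suc m) x)\<^sup>2 \<le>
    (x \<bullet> (frame_op h I ^^ m) x) * (x \<bullet> (frame_op h I ^^ Suc (Suc m)) x)"
proof -
  obtain N :: nat and g
    where g: "\<And>x y. x \<bullet> (frame_op h I ^^ m) y = (\<Sum>n<N. (g n \<bullet> x) * (g n \<bullet> y))"
    using frame_op_pow_gram[OF assms, of m h] by blast
  let ?Z = "frame_op h I"
  have 1: "x \<bullet> (?Z ^^ Suc m) x = (\<Sum>n<N. (g n \<bullet> x) * (g n \<bullet> ?Z x))"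
    by (simp add: funpow_Suc_right g[of x "?Z x", symmetric] del: funpow.simps)
  have "x \<bullet> (?Z ^^ Suc (Suc m)) x = ?Z x \<bullet> (?Z ^^ m) (?Z x)"
    by (simp add: frame_op_sym[symmetric] funpow_swap1)
  also have "\<dots> = (\<Sum>n<N. (g n \<bullet> ?Z x)\<^sup>2)"
    by (subst g) (simp add: power2_eq_square)
  finally have 2: "x \<bullet> (?Z ^^ Suc (Suc m)) x = (\<Sum>n<N. (g n \<bullet> ?Z x)\<^sup>2)" .
  have 0: "x \<bullet> (?Z ^^ m) x = (\<Sum>n<N. (g n \<bullet> x)\<^sup>2)"
    by (subst g) (simp add: power2_eq_square)
  show ?thesis unfolding 0 1 2 by (rule Cauchy_Schwarz_ineq_sum)
qed

lemma frame_op_pow_mult_le: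
  assumes "finite I"
  shows "(x \<bullet> (frame_op h I ^^ a) x) * (x \<bullet> (frame_op h I ^^ b) x) \<le>
    (x \<bullet> x) * (x \<bullet> (frame_op h I ^^ (a + b)) x)"
  using log_convex_mult_le[where s = "\<lambda>m. x \<bullet> (frame_op h I ^^ m) x" and a = a and b = b,
      OF frame_op_pow_nonneg[OF assms] frame_op_pow_log_convex[OF assms]]
  by simp

text \<open>Jensen's inequality for the spectral measure of the unit vector \<open>v\<close>,
  obtained one factor at a time from \<open>frame_op_pow_mult_le\<close> with
  \<open>a = 1\<close>.\<close>

lemma frame_op_pow_power_le:
  assumes "finite I" "norm v = 1"
  shows "(v \<bullet> frame_op h I v) ^ m \<le> v \<bullet> (frame_op h I ^^ m) v"
proof (induction m)
  case 0
  then show ?case using assms(2) by (simp add: dot_square_norm)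
next
  case (Suc m)
  have pos: "0 \<le> v \<bullet> frame_op h I v" using frame_op_pow_nonneg[OF assms(1), of v 1 h] by simp
  have "(v \<bullet> frame_op h I v) ^ Suc m \<le> (v \<bullet> frame_op h I v) * (v \<bullet> (frame_op h I ^^ m) v)"
    using mult_left_mono[OF Suc pos] by simp
  also have "\<dots> \<le> v \<bullet> (frame_op h I ^^ Suc m) v"
    using frame_op_pow_mult_le[OF assms(1), of v 1 h m] assms(2) by (simp add: dot_square_norm)
  finally show ?case .
qed

section \<open>Rank-one updates of powers\<close>

text \<open>The telescoping identity B^m - A^m = \<Sum> A^(m-1-i) (B - A) B^i at the vector
  \<open>h j\<close>; as B - A is the rank-one term of \<open>h j\<close>, each summand is a scalar
  times a power of A at \<open>h j\<close>.\<close>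

lemma frame_op_pow_insert_eq:
  assumes "finite I" "j \<notin> I"
  shows "(frame_op h (insert j I) ^^ m) (h j) = (frame_op h I ^^ m) (h j) +
    (\<Sum>i<m. (h j \<bullet> (frame_op h (insert j I) ^^ i) (h j)) *\<^sub>R (frame_op h I ^^ (m - 1 - i)) (h j))"
proof (induction m)
  case (Suc m)
  let ?A = "frame_op h I" and ?B = "frame_op h (insert j I)"
  define u where "u i = h j \<bullet> (?B ^^ i) (h j)" for i
  interpret A: linear ?A by (rule linear_frame_op)
  have B: "?B x = (h j \<bullet> x) *\<^sub>R h j + ?A x" for x
    using assms by (simp add: frame_op_def)
  have *: "?A ((?A ^^ (m - 1 - i)) (h j)) = (?A ^^ (m - i)) (h j)" if "i < m" for i
  proof -
    have "m - i = Suc (m - 1 - i)" using that by simp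
    then show ?thesis by (simp only: funpow.simps comp_apply)
  qed
  have "(?B ^^ Suc m) (h j) = u m *\<^sub>R h j + ?A ((?B ^^ m) (h j))"
    by (simp add: B u_def)
  also have "?A ((?B ^^ m) (h j)) =
      (?A ^^ Suc m) (h j) + (\<Sum>i<m. u i *\<^sub>R ?A ((?A ^^ (m - 1 - i)) (h j)))"
    unfolding Suc u_def[symmetric] by (simp add: A.add A.sum A.scale)
  also have "(\<Sum>i<m. u i *\<^sub>R ?A ((?A ^^ (m - 1 - i)) (h j))) = (\<Sum>i<m. u i *\<^sub>R (?A ^^ (m - i)) (h j))"
    by (intro sum.cong refl) (simp only: * lessThan_iff)
  finally show ?case by (simp add: u_def[symmetric])
qed simp

text \<open>Here \<open>u\<close> and \<open>s\<close> stand for the forms of B^m and A^m at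
  \<open>h j\<close>. The product bound on \<open>s\<close> makes the recursion behave as if A and
  the rank-one term commuted: the result is the binomial expansion of (A + L)^m.\<close>

lemma binomial_convolution_bound:
  fixes u s :: "nat \<Rightarrow> real"
  assumes u: "\<And>m. u m = s m + (\<Sum>i<m. u i * s (m - 1 - i))"
    and s: "\<And>a b. s a * s b \<le> L * s (a + b)" "\<And>a. 0 \<le> s a" and L: "0 \<le> L"
  shows "u m \<le> (\<Sum>k\<le>m. real (m choose k) * L ^ k * s (m - k))"
proof (induction m rule: less_induct)
  case (less m)
  have "u i * s (m - 1 - i) \<le> (\<Sum>k<m. real (i choose k) * (L ^ Suc k * s (m - Suc k)))" if i: "i < m" for i
  proof -
    have "u i * s (m - 1 - i) \<le> (\<Sum>k\<le>i. real (i choose k) * L ^ k * s (i - k)) * s (m - 1 - i)"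
      using less[OF i] s(2) by (rule mult_right_mono)
    also have "\<dots> = (\<Sum>k\<le>i. real (i choose k) * L ^ k * (s (i - k) * s (m - 1 - i)))"
      by (simp add: sum_distrib_right mult.assoc)
    also have "\<dots> \<le> (\<Sum>k\<le>i. real (i choose k) * L ^ k * (L * s (m - Suc k)))"
    proof (intro sum_mono mult_left_mono)
      fix k assume "k \<in> {..i}"
      then have "i - k + (m - 1 - i) = m - Suc k" using i by auto
      then show "s (i - k) * s (m - 1 - i) \<le> L * s (m - Suc k)" using s(1)[of "i - k" "m - 1 - i"] by simp
    qed (use L in auto)
    \<comment> \<open>Binomials with \<open>k > i\<close> vanish, so all inner sums share the range
      \<open>k < m\<close> and can be exchanged with the sum over \<open>i\<close>.\<close>
    also have "\<dots> = (\<Sum>k<m. real (i choose k) * (L ^ Suc k * s (m - Suc k)))"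
      using i by (intro sum.mono_neutral_cong_left) (auto simp: mult_ac)
    finally show ?thesis .
  qed
  then have "u m \<le> s m + (\<Sum>i<m. \<Sum>k<m. real (i choose k) * (L ^ Suc k * s (m - Suc k)))"
    unfolding u[of m] by (intro add_left_mono sum_mono) auto
  also have "(\<Sum>i<m. \<Sum>k<m. real (i choose k) * (L ^ Suc k * s (m - Suc k))) =
      (\<Sum>k<m. real (\<Sum>i<m. i choose k) * (L ^ Suc k * s (m - Suc k)))"
    by (subst sum.swap) (simp add: sum_distrib_right)
  also have "\<dots> = (\<Sum>k<m. real (m choose Suc k) * L ^ Suc k * s (m - Suc k))"
  proof (intro sum.cong refl)
    fix k assume "k \<in> {..<m}"
    then obtain n where m: "m = Suc n" by (cases m) auto
    \<comment> \<open>Hockey-stick identity.\<close>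
    have "(\<Sum>i<m. i choose k) = m choose Suc k"
      using sum_choose_upper[of k n] by (simp add: m lessThan_Suc_atMost atLeast0AtMost)
    then show "real (\<Sum>i<m. i choose k) * (L ^ Suc k * s (m - Suc k)) =
        real (m choose Suc k) * L ^ Suc k * s (m - Suc k)" by simp
  qed
  also have "s m + \<dots> = (\<Sum>k\<le>m. real (m choose k) * L ^ k * s (m - k))"
    by (simp add: sum.atMost_shift)
  finally show ?case .
qed

text \<open>Removes \<open>j\<close> from the operator at the price of powers of \<open>L\<close>.
  The case \<open>j \<in> I\<close> arises because \<open>poisson_mean_member\<close> lets
  \<open>I\<close> range over all subsets; there the term \<open>k = 0\<close> already equals the
  left side.\<close>

lemma frame_op_pow_insert_le:
  assumes I: "finite I" and L: "(norm (h j))\<^sup>2 \<le> L"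
  shows "h j \<bullet> (frame_op h (insert j I) ^^ m) (h j) \<le>
    (\<Sum>k\<le>m. real (m choose k) * L ^ k * (h j \<bullet> (frame_op h I ^^ (m - k)) (h j)))"
proof (cases "j \<in> I")
  case True
  have L0: "0 \<le> L" using L by (meson order_trans zero_le_power2)
  have "h j \<bullet> (frame_op h (insert j I) ^^ m) (h j) =
      (\<Sum>k\<in>{0}. real (m choose k) * L ^ k * (h j \<bullet> (frame_op h I ^^ (m - k)) (h j)))"
    using True by (simp add: insert_absorb)
  also have "\<dots> \<le> (\<Sum>k\<le>m. real (m choose k) * L ^ k * (h j \<bullet> (frame_op h I ^^ (m - k)) (h j)))"
    using L0 by (intro sum_mono2) (auto intro!: mult_nonneg_nonneg frame_op_pow_nonneg I)
  finally show ?thesis .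
next
  case False
  show ?thesis
  proof (rule binomial_convolution_bound)
    fix m
    show "h j \<bullet> (frame_op h (insert j I) ^^ m) (h j) = h j \<bullet> (frame_op h I ^^ m) (h j) +
      (\<Sum>i<m. h j \<bullet> (frame_op h (insert j I) ^^ i) (h j) * (h j \<bullet> (frame_op h I ^^ (m - 1 - i)) (h j)))"
      by (subst frame_op_pow_insert_eq[OF I False]) (simp add: inner_add_right inner_sum_right)
  next
    fix a b
    show "(h j \<bullet> (frame_op h I ^^ a) (h j)) * (h j \<bullet> (frame_op h I ^^ b) (h j)) \<le>
        L * (h j \<bullet> (frame_op h I ^^ (a + b)) (h j))"
      using frame_op_pow_mult_le[OF I, of "h j" a h b] mult_right_mono[OF L frame_op_pow_nonneg[OF I, of "h j" "a + b" h]]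
      by (simp add: dot_square_norm)
  qed (use frame_op_pow_nonneg[OF I] L in \<open>auto intro: order_trans[OF zero_le_power2]\<close>)
qed

section \<open>Traces of powers and their Poisson moments\<close>

lemma trace_pow_Suc:
  "trace_pow h I (Suc m) = (\<Sum>i\<in>I. h i \<bullet> (frame_op h I ^^ m) (h i))"
proof -
  interpret A: linear "frame_op h I ^^ m" by (rule linear_frame_op_pow)
  have "trace_pow h I (Suc m) = (\<Sum>b\<in>Basis. b \<bullet> (frame_op h I ^^ m) (frame_op h I b))"
    by (simp add: trace_pow_def funpow_swap1)
  also have "\<dots> = (\<Sum>b\<in>Basis. \<Sum>i\<in>I. (h i \<bullet> b) * ((frame_op h I ^^ m) (h i) \<bullet> b))"
    by (simp add: frame_op_def[of h I "_::'b"] A.sum A.scale inner_sum_right inner_commute[of _ "(_ ^^ _) _"])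
  also have "\<dots> = (\<Sum>i\<in>I. h i \<bullet> (frame_op h I ^^ m) (h i))"
    by (subst sum.swap) (rule sum.cong[OF refl euclidean_inner[symmetric]])
  finally show ?thesis .
qed

lemma trace_pow_nonneg: "finite I \<Longrightarrow> 0 \<le> trace_pow h I m"
  unfolding trace_pow_def by (intro sum_nonneg frame_op_pow_nonneg)

lemma trace_pow_gram:
  assumes "\<And>x y. x \<bullet> (frame_op h I ^^ m) y = (\<Sum>n<N. (g n \<bullet> x) * (g n \<bullet> y))"
  shows "trace_pow h I m = (\<Sum>n<N. (norm (g n))\<^sup>2)"
proof -
  have "trace_pow h I m = (\<Sum>n<N. \<Sum>b\<in>Basis. (g n \<bullet> b) * (g n \<bullet> b))"
    unfolding trace_pow_def assms by (rule sum.swap)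
  then show ?thesis by (simp add: euclidean_inner[symmetric] dot_square_norm)
qed

lemma frame_op_pow_le_trace_pow:
  assumes "finite I" "norm v = 1"
  shows "v \<bullet> (frame_op h I ^^ m) v \<le> trace_pow h I m"
proof -
  obtain N :: nat and g
    where g: "\<And>x y. x \<bullet> (frame_op h I ^^ m) y = (\<Sum>n<N. (g n \<bullet> x) * (g n \<bullet> y))"
    using frame_op_pow_gram[OF assms(1), of m h] by blast
  have "(g n \<bullet> v) * (g n \<bullet> v) \<le> (norm (g n))\<^sup>2" for n
    using Cauchy_Schwarz_ineq[of "g n" v] assms(2) by (simp add: dot_square_norm power2_eq_square[of "_ \<bullet> _"])
  then show ?thesis
    unfolding g trace_pow_gram[OF g] by (intro sum_mono) auto
qed

text \<open>The hypothesis is tested on the Gram vectors of Z^m, whose squared norms add up to tr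
  Z^m.\<close>

lemma weighted_trace_le:
  assumes "finite I" and "\<And>v. (\<Sum>j\<in>A. p j * (h j \<bullet> v)\<^sup>2) \<le> lam * (norm v)\<^sup>2"
  shows "(\<Sum>j\<in>A. p j * (h j \<bullet> (frame_op h I ^^ m) (h j))) \<le> lam * trace_pow h I m"
proof -
  obtain N :: nat and g
    where g: "\<And>x y. x \<bullet> (frame_op h I ^^ m) y = (\<Sum>n<N. (g n \<bullet> x) * (g n \<bullet> y))"
    using frame_op_pow_gram[OF assms(1), of m h] by blast
  have "(\<Sum>j\<in>A. p j * (h j \<bullet> (frame_op h I ^^ m) (h j))) =
      (\<Sum>n<N. \<Sum>j\<in>A. p j * (h j \<bullet> g n)\<^sup>2)"
    unfolding g by (subst sum.swap) (simp add: sum_distrib_left power2_eq_square inner_commute)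
  also have "\<dots> \<le> (\<Sum>n<N. lam * (norm (g n))\<^sup>2)" by (intro sum_mono assms)
  finally show ?thesis by (simp add: trace_pow_gram[OF g] sum_distrib_left)
qed

text \<open>tr Z^(m+1) is a sum over the selected \<open>j\<close>; each selection contributes
  \<open>p j\<close> and an operator with \<open>j\<close> inserted, which is expanded back to Z.
  With equality this is the recursion E X^(m+1) = lam E (X + L)^m of X = L N, N Poisson of mean lam
  / L.\<close>

lemma poisson_mean_trace_pow_Suc:
  assumes p: "\<And>i. p i \<in> {0..1}" and A: "finite A"
    and L: "\<And>j. j \<in> A \<Longrightarrow> (norm (h j))\<^sup>2 \<le> L" "0 \<le> L"
    and lam: "\<And>v. (\<Sum>j\<in>A. p j * (h j \<bullet> v)\<^sup>2) \<le> lam * (norm v)\<^sup>2"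
  shows "poisson_mean p A (\<lambda>I. trace_pow h I (Suc m)) \<le>
    lam * (\<Sum>k\<le>m. real (m choose k) * L ^ k * poisson_mean p A (\<lambda>I. trace_pow h I (m - k)))"
proof -
  have fin: "finite I" if "I \<subseteq> A" for I using that A finite_subset by blast
  have p0: "0 \<le> p j" for j using p[of j] by simp
  have "poisson_mean p A (\<lambda>I. trace_pow h I (Suc m)) =
      poisson_mean p A (\<lambda>I. \<Sum>j\<in>A. of_bool (j \<in> I) * (h j \<bullet> (frame_op h I ^^ m) (h j)))"
  proof (rule poisson_mean_cong)
    fix I assume I: "I \<subseteq> A"
    then show "trace_pow h I (Suc m) = (\<Sum>j\<in>A. of_bool (j \<in> I) * (h j \<bullet> (frame_op h I ^^ m) (h j)))"
      unfolding trace_pow_Suc using A by (intro sum.mono_neutral_cong_left) auto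
  qed
  also have "\<dots> = (\<Sum>j\<in>A. p j * poisson_mean p A (\<lambda>I. h j \<bullet> (frame_op h (insert j I) ^^ m) (h j)))"
    unfolding poisson_mean_sum by (intro sum.cong refl poisson_mean_member A)
  also have "\<dots> \<le> (\<Sum>j\<in>A. p j * poisson_mean p A
      (\<lambda>I. \<Sum>k\<le>m. real (m choose k) * L ^ k * (h j \<bullet> (frame_op h I ^^ (m - k)) (h j))))"
    by (intro sum_mono mult_left_mono poisson_mean_mono frame_op_pow_insert_le p p0 fin L) auto
  also have "\<dots> = (\<Sum>k\<le>m. real (m choose k) * L ^ k * poisson_mean p A
      (\<lambda>I. \<Sum>j\<in>A. p j * (h j \<bullet> (frame_op h I ^^ (m - k)) (h j))))"
    unfolding poisson_mean_sum poisson_mean_cmult sum_distrib_left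
    by (subst sum.swap) (simp add: mult_ac)
  also have "\<dots> \<le> (\<Sum>k\<le>m. real (m choose k) * L ^ k * poisson_mean p A
      (\<lambda>I. lam * trace_pow h I (m - k)))"
    by (intro sum_mono mult_left_mono poisson_mean_mono weighted_trace_le p lam fin) (use L in auto)
  also have "\<dots> = lam * (\<Sum>k\<le>m. real (m choose k) * L ^ k * poisson_mean p A (\<lambda>I. trace_pow h I (m - k)))"
    unfolding poisson_mean_cmult sum_distrib_left by (simp add: mult_ac)
  finally show ?thesis .
qed

section \<open>From moments to tail bounds\<close>

text \<open>The right side is \<open>f 0\<close> times the moment generating function of that scaled
  Poisson variable. The generating function F, truncated to avoid convergence questions, satisfies
  F' \<le> lam exp(L y) F, and Gronwall's argument applies.\<close>

lemma exponential_moment_bound: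
  fixes f :: "nat \<Rightarrow> real"
  assumes f: "\<And>m. 0 \<le> f m" "\<And>m. f (Suc m) \<le> lam * (\<Sum>k\<le>m. real (m choose k) * L ^ k * f (m - k))"
    and L: "0 < L" and lam: "0 \<le> lam" and x: "0 \<le> x"
  shows "(\<Sum>q\<le>n. x ^ q / fact q * f q) \<le> f 0 * exp (lam / L * (exp (L * x) - 1))"
proof -
  define F where "F y = (\<Sum>q\<le>n. f q / fact q * y ^ q)" for y
  define G where "G y = F y * exp (- (lam / L * (exp (L * y) - 1)))" for y
  define F' where "F' y = (\<Sum>q<n. f (Suc q) / fact q * y ^ q)" for y
  have dF: "(F has_real_derivative F' y) (at y)" for y
  proof -
    have "(F has_real_derivative (\<Sum>q\<le>n. f q / fact q * (real q * y ^ (q - Suc 0)))) (at y)"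
      unfolding F_def by (auto intro!: derivative_eq_intros sum.cong simp: mult_ac)
    also have "(\<Sum>q\<le>n. f q / fact q * (real q * y ^ (q - Suc 0))) = F' y"
    proof -
      have "f (Suc q) / fact (Suc q) * (real (Suc q) * y ^ q) = f (Suc q) / fact q * y ^ q" for q
      proof -
        have "(fact (Suc q) :: real) = real (Suc q) * fact q" by simp
        then show ?thesis by (simp only: times_divide_eq_left times_divide_eq_right) (simp add: divide_simps)
      qed
      then show ?thesis unfolding F'_def by (subst sum.atMost_shift) simp
    qed
    finally show ?thesis .
  qed
  have F'_le: "F' y \<le> lam * exp (L * y) * F y" if y: "0 \<le> y" for y
  proof -
    define a where "a k = (L * y) ^ k / fact k" for k
    define b where "b j = f j / fact j * y ^ j" for j
    have a0: "0 \<le> a k" and b0: "0 \<le> b k" for k using y L f by (auto simp: a_def b_def)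
    have "F' y \<le> (\<Sum>q<n. lam * (\<Sum>k\<le>q. a k * b (q - k)))"
      unfolding F'_def
    proof (rule sum_mono)
      fix q
      have "f (Suc q) / fact q * y ^ q \<le>
          lam * (\<Sum>k\<le>q. real (q choose k) * L ^ k * f (q - k)) / fact q * y ^ q"
        using y by (intro mult_right_mono divide_right_mono f) auto
      also have "\<dots> = lam * (\<Sum>k\<le>q. (real (q choose k) / fact q) * (L ^ k * f (q - k) * y ^ q))"
        by (simp add: sum_distrib_left sum_distrib_right sum_divide_distrib mult_ac)
      also have "(\<Sum>k\<le>q. (real (q choose k) / fact q) * (L ^ k * f (q - k) * y ^ q)) = (\<Sum>k\<le>q. a k * b (q - k))"
      proof (intro sum.cong refl)
        fix k assume k: "k \<in> {..q}"
        then have "real (q choose k) / fact q = 1 / (fact k * fact (q - k))"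
          by (simp add: binomial_fact)
        moreover have "y ^ q = y ^ k * y ^ (q - k)" using k by (simp flip: power_add)
        ultimately show "(real (q choose k) / fact q) * (L ^ k * f (q - k) * y ^ q) = a k * b (q - k)"
          by (simp add: a_def b_def power_mult_distrib)
      qed
      finally show "f (Suc q) / fact q * y ^ q \<le> lam * (\<Sum>k\<le>q. a k * b (q - k))" .
    qed
    also have "\<dots> = lam * (\<Sum>(i, j)\<in>{(i, j). i + j < n}. a i * b j)"
      by (subst sum.triangle_reindex) (simp add: sum_distrib_left)
    \<comment> \<open>The triangle of the Cauchy product is enlarged to a rectangle, where the
      double sum factors.\<close>
    also have "(\<Sum>(i, j)\<in>{(i, j). i + j < n}. a i * b j) \<le> (\<Sum>(i, j)\<in>{..<n} \<times> {..n}. a i * b j)"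
      using a0 b0 by (intro sum_mono2) auto
    also have "\<dots> = (\<Sum>i<n. a i) * (\<Sum>j\<le>n. b j)"
      by (simp add: sum_product sum.cartesian_product)
    also have "\<dots> \<le> exp (L * y) * (\<Sum>j\<le>n. b j)"
    proof (rule mult_right_mono)
      have s: "a sums exp (L * y)"
        using exp_converges[of "L * y"] unfolding a_def by (simp add: divide_inverse mult.commute)
      show "(\<Sum>i<n. a i) \<le> exp (L * y)"
        using sum_le_suminf[OF sums_summable[OF s], of "{..<n}"] a0 sums_unique[OF s] by auto
    qed (use b0 in \<open>simp add: sum_nonneg\<close>)
    finally show ?thesis using lam by (simp add: F_def b_def mult_left_mono mult.assoc)
  qed
  \<comment> \<open>The exponential in G is the reciprocal of the solution of F' = lam exp(L y) F
    with value 1 at 0, so G cannot increase.\<close>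
  have "G x \<le> G 0"
  proof (rule DERIV_nonpos_imp_nonincreasing[OF x])
    fix y assume y: "0 \<le> y" "y \<le> x"
    let ?E = "exp (- (lam / L * (exp (L * y) - 1)))"
    have "(G has_real_derivative (F' y * ?E + ?E * (- (lam / L * (exp (L * y) * L))) * F y)) (at y)"
      unfolding G_def by (auto intro!: derivative_eq_intros dF)
    moreover have "F' y * ?E + ?E * (- (lam / L * (exp (L * y) * L))) * F y = (F' y - lam * exp (L * y) * F y) * ?E"
      using L by (simp add: algebra_simps)
    moreover have "(F' y - lam * exp (L * y) * F y) * ?E \<le> 0"
      using F'_le[OF y(1)] by (intro mult_nonpos_nonneg) auto
    ultimately show "\<exists>z. DERIV G y :> z \<and> z \<le> 0" by metis
  qed
  moreover have "F 0 = f 0" unfolding F_def by (subst sum.atMost_shift) simp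
  then have "G 0 = f 0" by (simp add: G_def)
  ultimately have "F x * exp (- (lam / L * (exp (L * x) - 1))) \<le> f 0" by (simp add: G_def)
  then have "F x \<le> f 0 * exp (lam / L * (exp (L * x) - 1))"
    by (simp add: exp_minus divide_simps)
  then show ?thesis by (simp add: F_def mult_ac)
qed

text \<open>The event says that the top eigenvalue of Z is at least \<open>t\<close>. Markov's
  inequality for all trace moments is summed with exponential weights; the dimension enters as tr
  Z^0.\<close>

lemma matrix_chernoff:
  fixes h :: "'i \<Rightarrow> 'a::euclidean_space"
  assumes p: "\<And>i. p i \<in> {0..1}" and A: "finite A"
    and L: "\<And>j. j \<in> A \<Longrightarrow> (norm (h j))\<^sup>2 \<le> L" "0 < L"
    and lam: "\<And>v. (\<Sum>j\<in>A. p j * (h j \<bullet> v)\<^sup>2) \<le> lam * (norm v)\<^sup>2" "0 \<le> lam"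
    and t: "(exp 1)\<^sup>2 * lam \<le> t"
  shows "poisson_mean p A (\<lambda>I. of_bool (\<exists>v. norm v = 1 \<and> t \<le> (\<Sum>j\<in>I. (h j \<bullet> v)\<^sup>2)))
    \<le> real DIM('a) * exp (- t / L)"
proof -
  define P where "P = poisson_mean p A (\<lambda>I. of_bool (\<exists>v. norm v = 1 \<and> t \<le> (\<Sum>j\<in>I. (h j \<bullet> v)\<^sup>2)))"
  define f where "f m = poisson_mean p A (\<lambda>I. trace_pow h I m)" for m
  \<comment> \<open>With this exponent the moment factor is exp((e^2 - 1) lam / L) \<le> exp(t / L),
    while the event carries exp(2 t / L); the quotient is exp(-t / L).\<close>
  define x where "x = 2 / L"
  have x: "0 \<le> x" using L by (simp add: x_def)
  have t0: "0 \<le> t" using t lam(2) by (meson mult_nonneg_nonneg order_trans zero_le_power2)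
  have fin: "finite I" if "I \<subseteq> A" for I using that A finite_subset by blast
  have f0: "f 0 = real DIM('a)"
    by (simp add: f_def trace_pow_def poisson_mean_const[OF A] inner_Basis)
  have P_le: "t ^ q * P \<le> f q" for q
    unfolding P_def f_def poisson_mean_cmult[symmetric]
  proof (rule poisson_mean_mono[OF p])
    fix I assume I: "I \<subseteq> A"
    show "t ^ q * of_bool (\<exists>v. norm v = 1 \<and> t \<le> (\<Sum>j\<in>I. (h j \<bullet> v)\<^sup>2)) \<le> trace_pow h I q"
    proof (cases "\<exists>v. norm v = 1 \<and> t \<le> (\<Sum>j\<in>I. (h j \<bullet> v)\<^sup>2)")
      case True
      then obtain v where v: "norm v = 1" "t \<le> (\<Sum>j\<in>I. (h j \<bullet> v)\<^sup>2)" by blast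
      have "(\<Sum>j\<in>I. (h j \<bullet> v)\<^sup>2) = v \<bullet> frame_op h I v"
        by (simp add: frame_op_def inner_sum_right power2_eq_square inner_commute[of v])
      then have "t ^ q \<le> (v \<bullet> frame_op h I v) ^ q" using v t0 by (simp add: power_mono)
      also have "\<dots> \<le> v \<bullet> (frame_op h I ^^ q) v" by (rule frame_op_pow_power_le[OF fin[OF I] v(1)])
      also have "\<dots> \<le> trace_pow h I q" by (rule frame_op_pow_le_trace_pow[OF fin[OF I] v(1)])
      finally show ?thesis using True by simp
    qed (auto simp: trace_pow_nonneg fin[OF I])
  qed
  have bound: "(\<Sum>q\<le>n. (x * t) ^ q / fact q) * P \<le> real DIM('a) * exp (lam / L * (exp (L * x) - 1))" for n
  proof -
    have "(\<Sum>q\<le>n. (x * t) ^ q / fact q) * P = (\<Sum>q\<le>n. x ^ q / fact q * (t ^ q * P))"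
      by (simp add: sum_distrib_right power_mult_distrib mult_ac sum_distrib_left)
    also have "\<dots> \<le> (\<Sum>q\<le>n. x ^ q / fact q * f q)"
      using x by (intro sum_mono mult_left_mono P_le) auto
    also have "\<dots> \<le> f 0 * exp (lam / L * (exp (L * x) - 1))"
    proof (rule exponential_moment_bound)
      show "0 \<le> f m" for m
        unfolding f_def by (intro poisson_mean_nonneg p trace_pow_nonneg fin)
      show "f (Suc m) \<le> lam * (\<Sum>k\<le>m. real (m choose k) * L ^ k * f (m - k))" for m
        unfolding f_def using L by (intro poisson_mean_trace_pow_Suc p A lam) auto
    qed (use L lam x in auto)
    finally show ?thesis by (simp add: f0)
  qed
  have "(\<lambda>q. (x * t) ^ q / fact q) sums exp (x * t)"
    using exp_converges[of "x * t"] by (simp add: divide_inverse mult.commute)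
  then have "(\<lambda>n. \<Sum>q\<le>n. (x * t) ^ q / fact q) \<longlonglongrightarrow> exp (x * t)" by (simp add: sums_def_le)
  then have "(\<lambda>n. (\<Sum>q\<le>n. (x * t) ^ q / fact q) * P) \<longlonglongrightarrow> exp (x * t) * P" by (rule tendsto_mult_right)
  then have "exp (x * t) * P \<le> real DIM('a) * exp (lam / L * (exp (L * x) - 1))"
    by (rule LIMSEQ_le_const2) (use bound in auto)
  also have "lam / L * (exp (L * x) - 1) \<le> t / L"
  proof -
    have "exp (L * x) = (exp 1)\<^sup>2" using L by (simp add: x_def exp_of_nat_mult[of 2 1, simplified])
    then have "lam * (exp (L * x) - 1) \<le> t" using t lam(2) by (simp add: algebra_simps)
    then show ?thesis using L by (simp add: divide_right_mono)
  qed
  finally have "exp (x * t) * P \<le> real DIM('a) * exp (t / L)" by simp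
  then have "P \<le> real DIM('a) * exp (t / L) * exp (- (x * t))"
    by (simp add: exp_minus divide_simps mult.commute)
  also have "\<dots> = real DIM('a) * exp (- t / L)"
    by (simp add: x_def mult.assoc flip: exp_add)
  finally show ?thesis by (simp add: P_def)
qed

section \<open>From rejective to Poisson sampling\<close>

lemma poisson_mean_card_insert:
  assumes "finite A" "a \<notin> A"
  shows "poisson_mean p (insert a A) (\<lambda>I. f (real (card I))) =
    poisson_mean p A (\<lambda>I. p a * f (real (card I) + 1) + (1 - p a) * f (real (card I)))"
proof -
  have "poisson_mean p A (\<lambda>I. f (real (card (insert a I)))) = poisson_mean p A (\<lambda>I. f (real (card I) + 1))"
  proof (rule poisson_mean_cong)
    fix I assume "I \<subseteq> A"
    then have "finite I" "a \<notin> I" using assms finite_subset by auto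
    then show "f (real (card (insert a I))) = f (real (card I) + 1)" by (simp add: add.commute)
  qed
  then show ?thesis using assms by (simp add: poisson_mean_insert poisson_mean_add poisson_mean_cmult)
qed

lemma poisson_card_mean:
  assumes "finite A"
  shows "poisson_mean p A (\<lambda>I. real (card I) - (\<Sum>i\<in>A. p i)) = 0"
  using assms
proof induction
  case (insert a A)
  have "poisson_mean p (insert a A) (\<lambda>I. real (card I) - (\<Sum>i\<in>insert a A. p i)) =
      poisson_mean p A (\<lambda>I. real (card I) - (\<Sum>i\<in>A. p i))"
    using insert.hyps
    by (subst poisson_mean_card_insert) (auto intro!: poisson_mean_cong simp: algebra_simps)
  then show ?case using insert.IH by simp
qed simp

lemma poisson_card_variance:
  assumes "finite A"
  shows "poisson_mean p A (\<lambda>I. (real (card I) - (\<Sum>i\<in>A. p i))\<^sup>2) = (\<Sum>i\<in>A. p i * (1 - p i))"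
  using assms
proof induction
  case (insert a A)
  have "poisson_mean p (insert a A) (\<lambda>I. (real (card I) - (\<Sum>i\<in>insert a A. p i))\<^sup>2) =
      poisson_mean p A (\<lambda>I. (real (card I) - (\<Sum>i\<in>A. p i))\<^sup>2 + p a * (1 - p a))"
    using insert.hyps
    by (subst poisson_mean_card_insert)
      (auto intro!: poisson_mean_cong simp: algebra_simps power2_eq_square)
  then show ?case using insert
    by (simp add: poisson_mean_add poisson_mean_const)
qed simp

lemma poisson_card_fourth_moment:
  assumes "finite A" and p: "\<And>i. p i \<in> {0..1}"
  defines "V \<equiv> \<lambda>A. \<Sum>i\<in>A. p i * (1 - p i)"
  shows "poisson_mean p A (\<lambda>I. (real (card I) - (\<Sum>i\<in>A. p i)) ^ 4) \<le> 3 * (V A)\<^sup>2 + V A"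
  using assms(1)
proof induction
  case (insert a A)
  define v where "v = p a * (1 - p a)"
  define y where "y I = real (card I) - (\<Sum>i\<in>A. p i)" for I :: "'a set"
  have v: "0 \<le> v" using p[of a] by (simp add: v_def)
  have "poisson_mean p (insert a A) (\<lambda>I. (real (card I) - (\<Sum>i\<in>insert a A. p i)) ^ 4) =
      poisson_mean p A (\<lambda>I. y I ^ 4 + (6 * v) * (y I)\<^sup>2 + (4 * v * (1 - 2 * p a)) * y I + v * (1 - 3 * v))"
  proof (subst poisson_mean_card_insert, (use insert.hyps in simp_all)[2], rule poisson_mean_cong)
    fix I assume "I \<subseteq> A"
    \<comment> \<open>The left side averages (y + \<xi>)^4 over a centred Bernoulli \<xi>, whose
      second, third and fourth moments are v, v (1 - 2 p) and v (1 - 3 v).\<close>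
    have "p a * (y I + 1 - p a) ^ 4 + (1 - p a) * (y I - p a) ^ 4 =
        y I ^ 4 + (6 * v) * (y I)\<^sup>2 + (4 * v * (1 - 2 * p a)) * y I + v * (1 - 3 * v)"
      unfolding v_def by algebra
    moreover have "real (card I) + 1 - (\<Sum>i\<in>insert a A. p i) = y I + 1 - p a"
        "real (card I) - (\<Sum>i\<in>insert a A. p i) = y I - p a"
      using insert.hyps by (simp_all add: y_def)
    ultimately show "p a * (real (card I) + 1 - (\<Sum>i\<in>insert a A. p i)) ^ 4 +
        (1 - p a) * (real (card I) - (\<Sum>i\<in>insert a A. p i)) ^ 4 =
        y I ^ 4 + (6 * v) * (y I)\<^sup>2 + (4 * v * (1 - 2 * p a)) * y I + v * (1 - 3 * v)" by (simp only:)
  qed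
  also have "\<dots> = poisson_mean p A (\<lambda>I. y I ^ 4) + 6 * v * V A + v * (1 - 3 * v)"
    unfolding poisson_mean_add poisson_mean_cmult poisson_mean_const[OF insert.hyps(1)]
    using poisson_card_mean[OF insert.hyps(1), of p] poisson_card_variance[OF insert.hyps(1), of p]
    by (simp add: y_def V_def)
  also have "\<dots> \<le> 3 * (V A)\<^sup>2 + V A + 6 * v * V A + v"
  proof -
    have "v * (1 - 3 * v) \<le> v * 1" using v by (intro mult_left_mono) auto
    then show ?thesis using insert.IH by (simp add: y_def)
  qed
  also have "\<dots> \<le> 3 * (V A + v)\<^sup>2 + (V A + v)" by (simp add: power2_eq_square algebra_simps)
  also have "V A + v = V (insert a A)" using insert.hyps by (simp add: V_def v_def)
  finally show ?case .
qed (simp add: V_def)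

text \<open>The indicator is bounded below by a polynomial in the deviation y from the mean, and the
  expectation of the polynomial is controlled by the moments: a quadratic for small variance V, a
  quartic at scale sqrt V otherwise.\<close>

lemma poisson_card_ge_mean:
  assumes p: "\<And>i. p i \<in> {0..1}" and A: "finite A" and S: "(\<Sum>i\<in>A. p i) = real S"
  shows "1 / 8 \<le> poisson_mean p A (\<lambda>I. of_bool (S \<le> card I))"
proof -
  define V where "V = (\<Sum>i\<in>A. p i * (1 - p i))"
  define y where "y I = real (card I) - real S" for I :: "'a set"
  have m1: "poisson_mean p A y = 0"
    using poisson_card_mean[OF A, of p] by (simp add: y_def[abs_def] S)
  have m2: "poisson_mean p A (\<lambda>I. (y I)\<^sup>2) = V"
    using poisson_card_variance[OF A, of p] by (simp add: y_def V_def S)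
  have m4: "poisson_mean p A (\<lambda>I. y I ^ 4) \<le> 3 * V\<^sup>2 + V"
    using poisson_card_fourth_moment[where p = p, OF A p] by (simp add: y_def V_def S)
  show ?thesis
  proof (cases "V \<le> 3")
    case True
    \<comment> \<open>The minorant is 1 - (y - 3)^2 / 16: at most 1, and nonpositive for y \<le> -1,
      which is what \<open>card I < S\<close> means for integers. Its mean is (7 - V) / 16.\<close>
    have "1 / 8 \<le> poisson_mean p A (\<lambda>I. (-1/16) * (y I)\<^sup>2 + (6/16) * y I + 7/16)"
      unfolding poisson_mean_add poisson_mean_cmult poisson_mean_const[OF A] m1 m2 using True by simp
    also have "\<dots> \<le> poisson_mean p A (\<lambda>I. of_bool (S \<le> card I))"
    proof (rule poisson_mean_mono[OF p])
      fix I
      have sq: "(-1/16) * (y I)\<^sup>2 + (6/16) * y I + 7/16 = 1 - (y I - 3)\<^sup>2 / 16"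
        by (simp add: power2_eq_square field_simps)
      show "(-1/16) * (y I)\<^sup>2 + (6/16) * y I + 7/16 \<le> of_bool (S \<le> card I)"
      proof (cases "S \<le> card I")
        case False
        then have "4 \<le> 3 - y I" by (simp add: y_def)
        then have "4\<^sup>2 \<le> (3 - y I)\<^sup>2" by (intro power_mono) auto
        then have "16 \<le> (y I - 3)\<^sup>2" by (simp add: power2_commute)
        then show ?thesis using False unfolding sq by simp
      qed (unfold sq, simp)
    qed
    finally show ?thesis .
  next
    case False
    \<comment> \<open>The minorant is y (2 s - y) (y + s)^2 / (5 s^4): nonpositive for y \<le> 0, at
      most 1 by a sum of squares, and free of a cubic term. With s^2 = 2 V its numerator has mean at
      least 6 V^2 - (3 V^2 + V).\<close>
    define s where "s = sqrt (2 * V)"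
    have s: "s > 0" "s\<^sup>2 = 2 * V" using False by (simp_all add: s_def)
    have s4: "s ^ 4 = 4 * V\<^sup>2"
    proof -
      have "s ^ 4 = (s\<^sup>2)\<^sup>2" by simp
      then show ?thesis unfolding s(2) by (simp add: power_mult_distrib)
    qed
    have "5 * s ^ 4 * (1 / 8) \<le> 3 * V * (2 * V) - (3 * V\<^sup>2 + V)"
    proof -
      have "V * 2 \<le> V * V" using False by (intro mult_left_mono) auto
      then show ?thesis by (simp add: s4 power2_eq_square)
    qed
    also have "\<dots> \<le> poisson_mean p A (\<lambda>I. (2 * s ^ 3) * y I + (3 * s\<^sup>2) * (y I)\<^sup>2 + (-1) * y I ^ 4)"
      unfolding poisson_mean_add poisson_mean_cmult m1 m2 using m4 s(2) by (simp add: mult_ac)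
    also have "\<dots> \<le> poisson_mean p A (\<lambda>I. (5 * s ^ 4) * of_bool (S \<le> card I))"
    proof (rule poisson_mean_mono[OF p])
      fix I
      show "(2 * s ^ 3) * y I + (3 * s\<^sup>2) * (y I)\<^sup>2 + (-1) * y I ^ 4 \<le> (5 * s ^ 4) * of_bool (S \<le> card I)"
      proof (cases "S \<le> card I")
        case True
        have "5 * s ^ 4 - ((2 * s ^ 3) * y I + (3 * s\<^sup>2) * (y I)\<^sup>2 + (-1) * y I ^ 4) =
            ((y I)\<^sup>2 - 2 * s\<^sup>2)\<^sup>2 + s\<^sup>2 * (y I - s)\<^sup>2" by algebra
        then have "0 \<le> 5 * s ^ 4 - ((2 * s ^ 3) * y I + (3 * s\<^sup>2) * (y I)\<^sup>2 + (-1) * y I ^ 4)" by simp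
        then show ?thesis using True by simp
      next
        case False
        then have y: "y I \<le> 0" by (simp add: y_def)
        have "(2 * s ^ 3) * y I + (3 * s\<^sup>2) * (y I)\<^sup>2 + (-1) * y I ^ 4 = y I * ((2 * s - y I) * (y I + s)\<^sup>2)"
          by algebra
        also have "\<dots> \<le> 0" using y s(1) by (intro mult_nonpos_nonneg mult_nonneg_nonneg) auto
        finally show ?thesis using False by simp
      qed
    qed
    finally have "5 * s ^ 4 * (1 / 8) \<le> 5 * s ^ 4 * poisson_mean p A (\<lambda>I. of_bool (S \<le> card I))"
      by (simp only: poisson_mean_cmult)
    then show ?thesis using s(1) by (subst (asm) mult_le_cancel_left_pos) auto
  qed
qed

section \<open>Monotonicity in the sample size\<close>

lemma poisson_weight_eq_prod:
  assumes "finite A" "I \<subseteq> A"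
  shows "poisson_weight p A I = (\<Prod>i\<in>A. if i \<in> I then p i else 1 - p i)"
proof -
  have "(\<Prod>i\<in>A. if i \<in> I then p i else 1 - p i) = (\<Prod>i\<in>I \<union> (A - I). if i \<in> I then p i else 1 - p i)"
    using assms(2) by (simp add: Un_absorb1)
  also have "\<dots> = poisson_weight p A I"
    unfolding poisson_weight_def using assms finite_subset[OF assms(2,1)]
    by (subst prod.union_disjoint) auto
  finally show ?thesis by simp
qed

text \<open>Every index lies in as many of \<open>I \<union> X\<close>, \<open>J - X\<close> as of
  \<open>I\<close>, \<open>J\<close>, so both sides have the same factors.\<close>

lemma poisson_weight_swap:
  assumes "finite A" "I \<subseteq> A" "J \<subseteq> A" "X \<subseteq> J - I"
  shows "poisson_weight p A (I \<union> X) * poisson_weight p A (J - X) = poisson_weight p A I * poisson_weight p A J"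
proof -
  have "I \<union> X \<subseteq> A" "J - X \<subseteq> A" using assms by auto
  then show ?thesis
    using assms by (simp add: poisson_weight_eq_prod prod.distrib[symmetric])
      (intro prod.cong; auto)
qed

text \<open>Stochastic monotonicity in the sample size: moving a set of \<open>n - k\<close> elements of \<open>J - I\<close>
  from \<open>J\<close> to \<open>I\<close> preserves the joint weight of \<open>(I, J)\<close> and exchanges the two sizes.\<close>

lemma poisson_mean_card_swap_le:
  assumes p: "\<And>i. p i \<in> {0..1}" and A: "finite A" and kn: "k \<le> n"
    and F: "\<And>I J. I \<subseteq> J \<Longrightarrow> J \<subseteq> A \<Longrightarrow> F I \<Longrightarrow> F J"
  shows "poisson_mean p A (\<lambda>I. of_bool (card I = k \<and> F I)) * poisson_mean p A (\<lambda>I. of_bool (card I = n)) \<le>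
    poisson_mean p A (\<lambda>I. of_bool (card I = n \<and> F I)) * poisson_mean p A (\<lambda>I. of_bool (card I = k))"
proof -
  define w where "w = poisson_weight p A"
  define B where "B m = {I. I \<subseteq> A \<and> card I = m}" for m
  define C where "C D = {X. X \<subseteq> D \<and> card X = n - k}" for D :: "'a set"
  have fin: "finite I" if "I \<subseteq> A" for I using that A finite_subset by blast
  have finB: "finite (B m)" for m using A by (simp add: B_def)
  have finC: "finite (C D)" if "D \<subseteq> A" for D using fin[OF that] by (simp add: C_def)
  have w0: "0 \<le> w I" for I unfolding w_def by (rule poisson_weight_nonneg[OF p])
  have cardC: "card (C D) = card D choose (n - k)" if "D \<subseteq> A" for D
    unfolding C_def by (rule n_subsets[OF fin[OF that]])
  have card_diff: "card I + card (J - I) = card J + card (I - J)" if "I \<subseteq> A" "J \<subseteq> A" for I J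
  proof -
    have "card (I \<union> (J - I)) = card I + card (J - I)" "card (J \<union> (I - J)) = card J + card (I - J)"
      using fin[OF that(1)] fin[OF that(2)] by (intro card_Un_disjoint; auto)+
    moreover have "I \<union> (J - I) = J \<union> (I - J)" by auto
    ultimately show ?thesis by simp
  qed
  have mean: "poisson_mean p A (\<lambda>I. of_bool (card I = m \<and> G I)) = (\<Sum>I\<in>B m. w I * of_bool (G I))" for m G
    unfolding poisson_mean_def w_def[symmetric] using A
    by (intro sum.mono_neutral_cong_right) (auto simp: B_def)
  have mean': "poisson_mean p A (\<lambda>I. of_bool (card I = m)) = (\<Sum>I\<in>B m. w I)" for m
    using mean[of m "\<lambda>_. True"] by simp
  \<comment> \<open>The weight of a pair is spread evenly over the admissible sets \<open>X\<close>;
    at least one exists because \<open>n - k \<le> card (D I J)\<close>.\<close>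
  have expand: "(\<Sum>I\<in>B m. w I * of_bool (F I)) * (\<Sum>J\<in>B l. w J) =
      (\<Sum>((I, J), X)\<in>Sigma (B m \<times> B l) (\<lambda>(I, J). C (D I J)).
        w I * w J * of_bool (F I) / real (card (D I J) choose (n - k)))"
    if D: "\<And>I J. I \<in> B m \<Longrightarrow> J \<in> B l \<Longrightarrow> D I J \<subseteq> A \<and> n - k \<le> card (D I J)" for m l D
  proof -
    have "(\<Sum>((I, J), X)\<in>Sigma (B m \<times> B l) (\<lambda>(I, J). C (D I J)).
        w I * w J * of_bool (F I) / real (card (D I J) choose (n - k))) =
        (\<Sum>(I, J)\<in>B m \<times> B l. \<Sum>X\<in>C (D I J). w I * w J * of_bool (F I) / real (card (D I J) choose (n - k)))"
      using finB finC D by (subst sum.Sigma[symmetric]) (auto simp: case_prod_beta)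
    also have "\<dots> = (\<Sum>(I, J)\<in>B m \<times> B l. w I * w J * of_bool (F I))"
    proof (intro sum.cong refl, clarify)
      fix I J assume IJ: "I \<in> B m" "J \<in> B l"
      have "card (D I J) choose (n - k) \<noteq> 0" using D[OF IJ] by simp
      then show "(\<Sum>X\<in>C (D I J). w I * w J * of_bool (F I) / real (card (D I J) choose (n - k))) =
          w I * w J * of_bool (F I)"
        using D[OF IJ] by (simp add: cardC)
    qed
    also have "\<dots> = (\<Sum>I\<in>B m. w I * of_bool (F I)) * (\<Sum>J\<in>B l. w J)"
      unfolding sum_product sum.cartesian_product by (intro sum.cong) auto
    finally show ?thesis by simp
  qed
  have 1: "J - I \<subseteq> A \<and> n - k \<le> card (J - I)" if "I \<in> B k" "J \<in> B n" for I J
    using that card_diff[of I J] kn unfolding B_def by (intro conjI) (blast, simp)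
  have 2: "I - J \<subseteq> A \<and> n - k \<le> card (I - J)" if "I \<in> B n" "J \<in> B k" for I J
    using that card_diff[of I J] kn unfolding B_def by (intro conjI) (blast, simp)
  let ?S1 = "Sigma (B k \<times> B n) (\<lambda>(I, J). C (J - I))"
  let ?S2 = "Sigma (B n \<times> B k) (\<lambda>(I, J). C (I - J))"
  have "(\<Sum>I\<in>B k. w I * of_bool (F I)) * (\<Sum>J\<in>B n. w J) =
      (\<Sum>((I, J), X)\<in>?S1. w I * w J * of_bool (F I) / real (card (J - I) choose (n - k)))"
    by (rule expand) (rule 1)
  also have "\<dots> = (\<Sum>((I, J), X)\<in>?S2. w I * w J * of_bool (F (I - X)) / real (card (I - J) choose (n - k)))"
  proof (rule sum.reindex_bij_witness[where
        j = "\<lambda>((I, J), X). ((I \<union> X, J - X), X)" and i = "\<lambda>((I, J), X). ((I - X, J \<union> X), X)"], goal_cases)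
    case (1 a)
    then show ?case by (auto simp: C_def)
  next
    case (2 a)
    then obtain I J X where a: "a = ((I, J), X)" and IJ: "I \<subseteq> A" "card I = k" "J \<subseteq> A" "card J = n"
      and X: "X \<subseteq> J - I" "card X = n - k"
      by (auto simp: B_def C_def)
    have fX: "finite X" using X(1) IJ(3) fin by (meson Diff_subset finite_subset subset_trans)
    have "card (I \<union> X) = n" using X IJ kn fin[of I] fX by (subst card_Un_disjoint) auto
    moreover have "card (J - X) = k" using X IJ kn fX by (subst card_Diff_subset) auto
    ultimately show ?case using X IJ by (auto simp: a B_def C_def)
  next
    case (3 b)
    then show ?case by (auto simp: C_def)
  next
    case (4 b)
    then obtain I J X where b: "b = ((I, J), X)" and IJ: "I \<subseteq> A" "card I = n" "J \<subseteq> A" "card J = k"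
      and X: "X \<subseteq> I - J" "card X = n - k"
      by (auto simp: B_def C_def)
    have fX: "finite X" using X(1) IJ(1) fin by (meson Diff_subset finite_subset subset_trans)
    have "card (J \<union> X) = n" using X IJ kn fin[of J] fX by (subst card_Un_disjoint) auto
    moreover have "card (I - X) = k" using X IJ kn fX by (subst card_Diff_subset) auto
    ultimately show ?case using X IJ by (auto simp: b B_def C_def)
  next
    case (5 a)
    then obtain I J X where a: "a = ((I, J), X)" and IJ: "I \<subseteq> A" "card I = k" "J \<subseteq> A" "card J = n"
      and X: "X \<subseteq> J - I" "card X = n - k"
      by (auto simp: B_def C_def)
    have fX: "finite X" using X(1) IJ(3) fin by (meson Diff_subset finite_subset subset_trans)
    \<comment> \<open>The denominators agree: the difference of the image pair has |I - J| + (n - k)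
      = |J - I| elements, so both pairs admit equally many \<open>X\<close>.\<close>
    have "I \<union> X - (J - X) = (I - J) \<union> X" using X(1) by auto
    moreover have "card ((I - J) \<union> X) = card (I - J) + card X"
      using X(1) fX fin[OF IJ(1)] by (intro card_Un_disjoint) auto
    ultimately have "card (I \<union> X - (J - X)) = card (J - I)"
      using card_diff[OF IJ(1,3)] IJ X(2) kn by simp
    moreover have "I \<union> X - X = I" using X(1) by auto
    ultimately show ?case
      using poisson_weight_swap[OF A IJ(1,3) X(1), of p] by (simp add: a w_def)
  qed
  also have "\<dots> \<le> (\<Sum>((I, J), X)\<in>?S2. w I * w J * of_bool (F I) / real (card (I - J) choose (n - k)))"
  proof (rule sum_mono)
    fix a assume "a \<in> ?S2"
    then obtain I J X where a: "a = ((I, J), X)" and I: "I \<subseteq> A" by (auto simp: B_def)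
    have "of_bool (F (I - X)) \<le> (of_bool (F I) :: real)" using F[of "I - X" I] I by auto
    then have "w I * w J * of_bool (F (I - X)) / real (card (I - J) choose (n - k)) \<le>
        w I * w J * of_bool (F I) / real (card (I - J) choose (n - k))"
      by (intro divide_right_mono mult_left_mono mult_nonneg_nonneg w0) auto
    then show "(case a of (x, X) \<Rightarrow> (case x of (I, J) \<Rightarrow> \<lambda>X. w I * w J * of_bool (F (I - X)) /
          real (card (I - J) choose (n - k))) X) \<le>
        (case a of (x, X) \<Rightarrow> (case x of (I, J) \<Rightarrow> \<lambda>X. w I * w J * of_bool (F I) /
          real (card (I - J) choose (n - k))) X)"
      by (simp add: a)
  qed
  also have "\<dots> = (\<Sum>I\<in>B n. w I * of_bool (F I)) * (\<Sum>J\<in>B k. w J)"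
    by (rule expand[symmetric]) (rule 2)
  finally show ?thesis unfolding mean mean' .
qed

text \<open>Let f n and g n be the probabilities of size n with and without F. Summing f S g n \<le>
  f n g S over n \<ge> S leaves on the left f S times a probability that is at least 1/8, and on the
  right at most the probability of F times g S.\<close>

lemma poisson_mean_card_eq_le:
  assumes p: "\<And>i. p i \<in> {0..1}" and A: "finite A" and S: "(\<Sum>i\<in>A. p i) = real S"
    and F: "\<And>I J. I \<subseteq> J \<Longrightarrow> J \<subseteq> A \<Longrightarrow> F I \<Longrightarrow> F J"
  shows "poisson_mean p A (\<lambda>I. of_bool (card I = S \<and> F I)) \<le>
    8 * poisson_mean p A (\<lambda>I. of_bool (F I)) * poisson_mean p A (\<lambda>I. of_bool (card I = S))"
proof -
  define f where "f n = poisson_mean p A (\<lambda>I. of_bool (card I = n \<and> F I))" for n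
  define g where "g n = poisson_mean p A (\<lambda>I. of_bool (card I = n))" for n
  have card_le: "card I \<le> card A" if "I \<subseteq> A" for I using that A by (rule card_mono[rotated])
  have 0: "0 \<le> f n" "0 \<le> g n" for n unfolding f_def g_def by (auto intro!: poisson_mean_nonneg p)
  have "f S / 8 \<le> f S * poisson_mean p A (\<lambda>I. of_bool (S \<le> card I))"
    using mult_left_mono[OF poisson_card_ge_mean[OF p A S] 0(1)[of S]] by simp
  also have "poisson_mean p A (\<lambda>I. of_bool (S \<le> card I)) = (\<Sum>n\<in>{S..card A}. g n)"
    unfolding g_def poisson_mean_sum[symmetric]
    by (rule poisson_mean_cong) (use card_le in \<open>auto simp: of_bool_def\<close>)
  also have "f S * \<dots> \<le> (\<Sum>n\<in>{S..card A}. f n * g S)"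
    unfolding sum_distrib_left f_def g_def 
    by (rule sum_mono, rule poisson_mean_card_swap_le[where F = F, OF p A _ F]) auto
  also have "\<dots> = (\<Sum>n\<in>{S..card A}. f n) * g S" by (simp add: sum_distrib_right)
  also have "\<dots> \<le> poisson_mean p A (\<lambda>I. of_bool (F I)) * g S"
  proof (rule mult_right_mono)
    show "(\<Sum>n\<in>{S..card A}. f n) \<le> poisson_mean p A (\<lambda>I. of_bool (F I))"
      unfolding f_def poisson_mean_sum[symmetric]
    proof (rule poisson_mean_mono[OF p])
      fix I
      have "(\<Sum>n\<in>{S..card A}. of_bool (card I = n \<and> F I)) = (\<Sum>n\<in>{S..card A} \<inter> {card I}. of_bool (F I) :: real)"
        by (intro sum.mono_neutral_cong_right) auto
      also have "\<dots> \<le> (\<Sum>n\<in>{card I}. of_bool (F I))" by (intro sum_mono2) auto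
      finally show "(\<Sum>n\<in>{S..card A}. of_bool (card I = n \<and> F I)) \<le> (of_bool (F I) :: real)" by simp
    qed
  qed (rule 0)
  finally show ?thesis by (simp add: f_def g_def)
qed

section \<open>Transfer to the sampling laws\<close>

lemma prob_poisson_sampling:
  fixes p :: "'k::finite \<Rightarrow> real"
  assumes "\<And>i. p i \<in> {0..1}"
  shows "measure_pmf.prob (poisson_sampling p) {I. E I} = poisson_mean p UNIV (\<lambda>I. of_bool (E I))"
proof -
  have "pmf (poisson_sampling p) I = poisson_weight p UNIV I" for I
    using assms by (simp add: pmf_poisson_sampling poisson_weight_def Compl_eq_Diff_UNIV)
  then show ?thesis
    unfolding poisson_mean_def
    by (subst measure_measure_pmf_finite) (auto intro!: sum.mono_neutral_cong_left)
qed

lemma prob_rejective_sampling_le: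
  fixes p :: "'k::finite \<Rightarrow> real"
  assumes p: "\<And>i. p i \<in> {0..1}" and S: "(\<Sum>i\<in>UNIV. p i) = real S"
    and F: "\<And>I J. I \<subseteq> J \<Longrightarrow> F I \<Longrightarrow> F J"
  shows "measure_pmf.prob (rejective_sampling p S) {I. F I} \<le> 8 * poisson_mean p UNIV (\<lambda>I. of_bool (F I))"
proof -
  let ?P = "measure_pmf.prob (poisson_sampling p)"
  have ne: "set_pmf (poisson_sampling p) \<inter> {I. card I = S} \<noteq> {}"
    using p by (intro poisson_sampling_card_possible S) auto
  have pos: "0 < ?P {I. card I = S}"
    using ne by (auto simp: measure_pmf_posI)
  have "measure_pmf.prob (rejective_sampling p S) {I. F I} = ?P {I. card I = S \<and> F I} / ?P {I. card I = S}"
  proof -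
    have "measure_pmf.prob (rejective_sampling p S) {I. F I} =
        (\<Sum>I\<in>{I. F I}. if card I = S then pmf (poisson_sampling p) I / ?P {I. card I = S} else 0)"
      unfolding rejective_sampling_def
      by (subst measure_measure_pmf_finite) (auto intro!: sum.cong simp: pmf_cond[OF ne])
    also have "\<dots> = (\<Sum>I\<in>{I. card I = S \<and> F I}. pmf (poisson_sampling p) I / ?P {I. card I = S})"
      by (intro sum.mono_neutral_cong_right) auto
    finally show ?thesis by (simp add: measure_measure_pmf_finite sum_divide_distrib)
  qed
  also have "\<dots> \<le> 8 * poisson_mean p UNIV (\<lambda>I. of_bool (F I))"
    using poisson_mean_card_eq_le[where p = p and F = F, OF p finite S F] pos
    by (simp add: prob_poisson_sampling[OF p] divide_le_eq)
  finally show ?thesis .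
qed

section \<open>The norm of a random principal submatrix\<close>

text \<open>The principal submatrix on \<open>I\<close> has operator norm at least 4/5, stated with
  vectors of the full space so that all \<open>I\<close> share one type. The value 4/5 leaves 4/15 >
  1/4 for decoupling and 5/12 < 1/2 for the pursuit.\<close>

definition submatrix_large :: "real ^ 'k ^ 'k \<Rightarrow> 'k set \<Rightarrow> bool" where
  "submatrix_large H I \<longleftrightarrow> (\<exists>x y. norm x \<le> 1 \<and> norm y \<le> 1 \<and>
     4 / 5 \<le> \<bar>\<Sum>i\<in>I. \<Sum>j\<in>I. x $ i * H $ i $ j * y $ j\<bar>)"

text \<open>The block with rows \<open>I \<inter> T\<close> and columns \<open>I - T\<close> has
  norm at least 1/4, phrased as the event of \<open>matrix_chernoff\<close> for its rows.\<close>

definition cross_block_large :: "real ^ 'k ^ 'k \<Rightarrow> 'k set \<Rightarrow> 'k set \<Rightarrow> bool" where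
  "cross_block_large H T I \<longleftrightarrow> (\<exists>v. norm v = 1 \<and>
     1 / 16 \<le> (\<Sum>i\<in>I \<inter> T. ((\<chi> j. if j \<in> I - T then H $ i $ j else 0) \<bullet> v)\<^sup>2))"

lemma norm_vec_power2: "(norm (x :: real ^ 'k))\<^sup>2 = (\<Sum>i\<in>UNIV. (x $ i)\<^sup>2)"
  by (simp add: norm_vec_def L2_set_def sum_nonneg)

lemma norm_restrict_power2:
  "(norm (\<chi> i. if i \<in> I then (x :: real ^ 'k) $ i else 0))\<^sup>2 = (\<Sum>i\<in>I. (x $ i)\<^sup>2)"
proof -
  have "(\<Sum>i\<in>UNIV. (if i \<in> I then x $ i else 0)\<^sup>2) = (\<Sum>i\<in>I. (x $ i)\<^sup>2)"
    by (intro sum.mono_neutral_cong_right) auto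
  then show ?thesis by (simp add: norm_vec_power2)
qed

lemma submatrix_large_mono:
  assumes "submatrix_large H I" "I \<subseteq> J"
  shows "submatrix_large H J"
proof -
  obtain x y where xy: "norm x \<le> 1" "norm y \<le> 1"
      "4 / 5 \<le> \<bar>\<Sum>i\<in>I. \<Sum>j\<in>I. x $ i * H $ i $ j * y $ j\<bar>"
    using assms(1) by (auto simp: submatrix_large_def)
  define r where "r x = (\<chi> i. if i \<in> I then x $ i else 0)" for x :: "real ^ 'a"
  have r: "norm (r x) \<le> norm x" for x
    unfolding r_def by (rule norm_le_componentwise_cart) simp
  have "(\<Sum>i\<in>J. \<Sum>j\<in>J. r x $ i * H $ i $ j * r y $ j) = (\<Sum>i\<in>I. \<Sum>j\<in>I. x $ i * H $ i $ j * y $ j)"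
    using assms(2)
    by (intro sum.mono_neutral_cong_right ballI sum.neutral) (auto simp: r_def)
  then show ?thesis
    using xy r[of x] r[of y] unfolding submatrix_large_def
    by (intro exI[of _ "r x"] exI[of _ "r y"]) auto
qed

lemma sum_square_inner_le_homogeneous:
  fixes h :: "'i \<Rightarrow> 'a::euclidean_space"
  assumes "\<And>v. norm v = 1 \<Longrightarrow> (\<Sum>j\<in>I. (h j \<bullet> v)\<^sup>2) < t"
  shows "(\<Sum>j\<in>I. (h j \<bullet> v)\<^sup>2) \<le> t * (norm v)\<^sup>2"
proof (cases "v = 0")
  case False
  define w where "w = v /\<^sub>R norm v"
  have w: "norm w = 1" "v = norm v *\<^sub>R w" using False by (simp_all add: w_def)
  have "(\<Sum>j\<in>I. (h j \<bullet> v)\<^sup>2) = (\<Sum>j\<in>I. (h j \<bullet> (norm v *\<^sub>R w))\<^sup>2)" using w(2) by simp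
  also have "\<dots> = (\<Sum>j\<in>I. (h j \<bullet> w)\<^sup>2) * (norm v)\<^sup>2"
    by (simp add: power_mult_distrib sum_distrib_left mult.commute)
  also have "\<dots> \<le> t * (norm v)\<^sup>2" using assms[OF w(1)] by (intro mult_right_mono) auto
  finally show ?thesis .
qed simp

section \<open>Decoupling by a random cut\<close>

text \<open>Toggling the membership of \<open>i\<close> is an involution on the cuts that flips the
  sign of the product.\<close>

lemma sum_random_signs_eq_0:
  fixes i j :: "'k::finite"
  assumes "i \<noteq> j"
  shows "(\<Sum>T\<in>UNIV. (if i \<in> T then 1 else -1) * (if j \<in> T then 1 else -1)) = (0 :: real)"
proof -
  define f where "f T = (if i \<in> T then 1 else -1) * (if j \<in> T then 1 else -1 :: real)" for T
  have "(\<Sum>T\<in>UNIV. f T) = (\<Sum>T\<in>UNIV. - f T)"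
    by (rule sum.reindex_bij_witness[where
          i = "\<lambda>T. if i \<in> T then T - {i} else insert i T" and j = "\<lambda>T. if i \<in> T then T - {i} else insert i T"])
      (use assms in \<open>auto simp: f_def\<close>)
  then show ?thesis by (simp add: sum_negf f_def)
qed

text \<open>A random cut \<open>T\<close> keeps half of a hollow form on average and never more than all of it.\<close>

lemma cross_form_often_large:
  fixes H :: "real ^ 'k ^ 'k"
  assumes hollow: "\<And>i. H $ i $ i = 0" and large: "submatrix_large H I"
  defines "f \<equiv> \<lambda>T x y. (\<Sum>i\<in>I \<inter> T. \<Sum>j\<in>I - T. x $ i * H $ i $ j * y $ j) +
      (\<Sum>i\<in>I - T. \<Sum>j\<in>I \<inter> T. x $ i * H $ i $ j * y $ j)"
  shows "2 ^ CARD('k) \<le> 4 * real (card {T. \<exists>x y. norm x \<le> 1 \<and> norm y \<le> 1 \<and> 4 / 15 \<le> \<bar>f T x y\<bar>})"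
proof -
  define B where "B x y = (\<Sum>i\<in>I. \<Sum>j\<in>I. x $ i * H $ i $ j * y $ j)" for x y :: "real ^ 'k"
  define U where "U = cball (0 :: real ^ 'k) 1 \<times> cball (0 :: real ^ 'k) 1"
  have "compact U" "U \<noteq> {}" unfolding U_def by (simp_all add: compact_Times)
  moreover have "continuous_on U (\<lambda>z. \<bar>B (fst z) (snd z)\<bar>)"
    unfolding B_def by (intro continuous_intros)
  \<comment> \<open>Fixing a maximiser lets one pair \<open>x\<close>, \<open>y\<close> serve every
    cut, with its value M bounding the form at all sign changes of the pair.\<close>
  ultimately have "\<exists>z\<in>U. \<forall>z'\<in>U. \<bar>B (fst z') (snd z')\<bar> \<le> \<bar>B (fst z) (snd z)\<bar>"
    by (rule continuous_attains_sup)
  then obtain z where z: "z \<in> U" "\<And>z'. z' \<in> U \<Longrightarrow> \<bar>B (fst z') (snd z')\<bar> \<le> \<bar>B (fst z) (snd z)\<bar>"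
    by blast
  obtain x y where xy: "z = (x, y)" by (cases z)
  have xy1: "norm x \<le> 1" "norm y \<le> 1" using z(1) by (auto simp: xy U_def)
  define M where "M = \<bar>B x y\<bar>"
  have max: "\<bar>B u v\<bar> \<le> M" if "norm u \<le> 1" "norm v \<le> 1" for u v
    using z(2)[of "(u, v)"] that by (simp add: xy M_def U_def)
  have M: "4 / 5 \<le> M"
  proof -
    obtain u v where "norm u \<le> 1" "norm v \<le> 1" "4 / 5 \<le> \<bar>B u v\<bar>"
      using large unfolding submatrix_large_def B_def by blast
    then show ?thesis using max[of u v] by simp
  qed
  define s where "s T i = (if i \<in> T then 1 else -1 :: real)" for T and i :: 'k
  define D where "D T u = (\<chi> i. s T i * u $ i)" for T and u :: "real ^ 'k"
  have D: "norm (D T u) = norm u" for T u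
    unfolding norm_eq_sqrt_inner by (auto simp: inner_vec_def D_def s_def intro!: sum.cong)
  \<comment> \<open>Flipping the signs outside \<open>T\<close> negates exactly the terms whose two
    indices the cut separates, so the difference keeps those terms twice.\<close>
  have f: "f T x y = (B x y - B (D T x) (D T y)) / 2" for T
  proof -
    define a where "a i j = x $ i * H $ i $ j * y $ j" for i j
    have "B x y - B (D T x) (D T y) = (\<Sum>i\<in>I. \<Sum>j\<in>I. (1 - s T i * s T j) * a i j)"
      unfolding B_def a_def D_def by (simp add: sum_subtractf algebra_simps)
    also have "\<dots> = (\<Sum>i\<in>I. (if i \<in> T then 2 * (\<Sum>j\<in>I - T. a i j) else 2 * (\<Sum>j\<in>I \<inter> T. a i j)))"
    proof (intro sum.cong refl)
      fix i assume "i \<in> I"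
      show "(\<Sum>j\<in>I. (1 - s T i * s T j) * a i j) = 
          (if i \<in> T then 2 * (\<Sum>j\<in>I - T. a i j) else 2 * (\<Sum>j\<in>I \<inter> T. a i j))"
        unfolding sum_distrib_left by (auto simp: s_def split: if_splits intro!: sum.mono_neutral_cong_right)
    qed
    also have "\<dots> = (\<Sum>i\<in>(I \<inter> T) \<union> (I - T). (if i \<in> T then 2 * (\<Sum>j\<in>I - T. a i j) else 2 * (\<Sum>j\<in>I \<inter> T. a i j)))"
      by (simp add: Un_Diff_Int Un_commute)
    also have "\<dots> = 2 * f T x y"
      unfolding f_def a_def by (subst sum.union_disjoint) (auto simp: sum_distrib_left)
    finally show ?thesis by simp
  qed
  have sumB: "(\<Sum>T\<in>UNIV. B (D T x) (D T y)) = 0"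
  proof -
    have "(\<Sum>T\<in>UNIV. B (D T x) (D T y)) =
        (\<Sum>T\<in>UNIV. \<Sum>i\<in>I. \<Sum>j\<in>I. (s T i * s T j) * (x $ i * H $ i $ j * y $ j))"
      by (simp add: B_def D_def mult_ac)
    also have "\<dots> = (\<Sum>i\<in>I. \<Sum>j\<in>I. (\<Sum>T\<in>UNIV. s T i * s T j) * (x $ i * H $ i $ j * y $ j))"
      by (simp add: sum.swap[of _ UNIV] sum_distrib_right)
    also have "\<dots> = 0"
    proof (intro sum.neutral ballI)
      fix i j
      show "(\<Sum>T\<in>UNIV. s T i * s T j) * (x $ i * H $ i $ j * y $ j) = 0"
        using sum_random_signs_eq_0[of i j] hollow[of i] by (cases "i = j") (simp_all add: s_def)
    qed
    finally show ?thesis .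
  qed
  define G where "G = {T. M / 3 \<le> \<bar>f T x y\<bar>}"
  have sgn: "sgn (B x y) * B x y = M" by (simp add: M_def abs_sgn mult.commute)
  \<comment> \<open>Reverse Markov: the signed values average M / 2 and never exceed M, so at least
    a quarter of the cuts reach M / 3 \<ge> 4/15 in absolute value.\<close>
  have "2 ^ CARD('k) * (M / 2) = (\<Sum>T\<in>UNIV. sgn (B x y) * f T x y)"
  proof -
    have "(\<Sum>T\<in>(UNIV :: 'k set set). sgn (B x y) * f T x y) =
        (\<Sum>T\<in>(UNIV :: 'k set set). M / 2) - sgn (B x y) / 2 * (\<Sum>T\<in>UNIV. B (D T x) (D T y))"
      unfolding sum_distrib_left sum_subtractf[symmetric] f
      by (intro sum.cong refl) (simp add: sgn[symmetric] algebra_simps diff_divide_distrib)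
    then show ?thesis by (simp add: sumB card_UNIV_set)
  qed
  also have "\<dots> \<le> (\<Sum>T\<in>UNIV. M / 3 + (2 / 3 * M) * of_bool (T \<in> G))"
  proof (rule sum_mono)
    fix T
    have 1: "sgn (B x y) * f T x y \<le> \<bar>f T x y\<bar>"
      by (auto simp: sgn_real_def)
    have 2: "\<bar>f T x y\<bar> \<le> M"
      using max[of "D T x" "D T y"] xy1 D unfolding f by (simp add: M_def)
    show "sgn (B x y) * f T x y \<le> M / 3 + (2 / 3 * M) * of_bool (T \<in> G)"
      using 1 2 by (cases "T \<in> G") (auto simp: G_def)
  qed
  also have "\<dots> = 2 ^ CARD('k) * (M / 3) + (2 / 3 * M) * real (card G)"
    unfolding sum.distrib sum_distrib_left[symmetric] by (simp add: card_UNIV_set)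
  finally have "2 ^ CARD('k) * M \<le> 4 * real (card G) * M" by (simp add: field_simps)
  then have "2 ^ CARD('k) \<le> 4 * real (card G)" using M by simp
  also have "real (card G) \<le> real (card {T. \<exists>x y. norm x \<le> 1 \<and> norm y \<le> 1 \<and> 4 / 15 \<le> \<bar>f T x y\<bar>})"
  proof -
    have "G \<subseteq> {T. \<exists>x y. norm x \<le> 1 \<and> norm y \<le> 1 \<and> 4 / 15 \<le> \<bar>f T x y\<bar>}"
      using M xy1 unfolding G_def by force
    then show ?thesis by (simp add: card_mono)
  qed
  finally show ?thesis by simp
qed

text \<open>By symmetry of \<open>H\<close> both halves of the form live on one block. If its norm
  were below 1/4, together they would be at most 1/4 < 4/15.\<close>

lemma cross_block_large_if_form_large:
  fixes H :: "real ^ 'k ^ 'k"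
  assumes sym: "\<And>i j. H $ i $ j = H $ j $ i" and xy: "norm x \<le> 1" "norm y \<le> 1"
    and large: "4 / 15 \<le> \<bar>(\<Sum>i\<in>I \<inter> T. \<Sum>j\<in>I - T. x $ i * H $ i $ j * y $ j) +
      (\<Sum>i\<in>I - T. \<Sum>j\<in>I \<inter> T. x $ i * H $ i $ j * y $ j)\<bar>"
  shows "cross_block_large H T I"
proof (rule ccontr)
  assume not: "\<not> cross_block_large H T I"
  define h where "h i = (\<chi> j. if j \<in> I - T then H $ i $ j else 0)" for i
  have h: "(\<Sum>i\<in>I \<inter> T. (h i \<bullet> v)\<^sup>2) \<le> 1 / 16 * (norm v)\<^sup>2" for v
    by (rule sum_square_inner_le_homogeneous)
      (use not in \<open>auto simp: cross_block_large_def h_def not_le\<close>)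
  have bound: "\<bar>\<Sum>i\<in>I \<inter> T. \<Sum>j\<in>I - T. u $ i * H $ i $ j * v $ j\<bar> \<le>
      (\<Sum>i\<in>I \<inter> T. (u $ i)\<^sup>2) / 8 + (\<Sum>j\<in>I - T. (v $ j)\<^sup>2) / 8" for u v :: "real ^ 'k"
  proof -
    define w where "w = (\<chi> j. if j \<in> I - T then v $ j else 0)"
    have hw: "h i \<bullet> w = (\<Sum>j\<in>I - T. H $ i $ j * v $ j)" for i
      unfolding h_def w_def inner_vec_def by (intro sum.mono_neutral_cong_right) auto
    have "\<bar>\<Sum>i\<in>I \<inter> T. \<Sum>j\<in>I - T. u $ i * H $ i $ j * v $ j\<bar> = \<bar>\<Sum>i\<in>I \<inter> T. u $ i * (h i \<bullet> w)\<bar>"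
      by (simp add: hw sum_distrib_left mult.assoc)
    also have "\<dots> \<le> (\<Sum>i\<in>I \<inter> T. \<bar>u $ i * (h i \<bullet> w)\<bar>)" by (rule sum_abs)
    \<comment> \<open>AM-GM balanced against the bound 1/16 for the squared block: 2 / 16 = 1 / 8
      gives both vectors the same factor.\<close>
    also have "\<dots> \<le> (\<Sum>i\<in>I \<inter> T. (u $ i)\<^sup>2 / 8 + 2 * (h i \<bullet> w)\<^sup>2)"
    proof (rule sum_mono)
      fix i
      have "0 \<le> (\<bar>u $ i\<bar> - 4 * \<bar>h i \<bullet> w\<bar>)\<^sup>2" by simp
      then show "\<bar>u $ i * (h i \<bullet> w)\<bar> \<le> (u $ i)\<^sup>2 / 8 + 2 * (h i \<bullet> w)\<^sup>2"
        by (simp add: power2_diff power_mult_distrib abs_mult)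
    qed
    also have "\<dots> = (\<Sum>i\<in>I \<inter> T. (u $ i)\<^sup>2) / 8 + 2 * (\<Sum>i\<in>I \<inter> T. (h i \<bullet> w)\<^sup>2)"
      by (simp add: sum.distrib sum_divide_distrib sum_distrib_left)
    also have "\<dots> \<le> (\<Sum>i\<in>I \<inter> T. (u $ i)\<^sup>2) / 8 + (\<Sum>j\<in>I - T. (v $ j)\<^sup>2) / 8"
      using h[of w] by (simp add: w_def norm_restrict_power2 del: Diff_iff)
    finally show ?thesis .
  qed
  have "(\<Sum>i\<in>I - T. \<Sum>j\<in>I \<inter> T. x $ i * H $ i $ j * y $ j) = (\<Sum>i\<in>I \<inter> T. \<Sum>j\<in>I - T. y $ i * H $ i $ j * x $ j)"
    by (subst sum.swap) (simp add: sym mult_ac)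
  then have "4 / 15 \<le> \<bar>\<Sum>i\<in>I \<inter> T. \<Sum>j\<in>I - T. x $ i * H $ i $ j * y $ j\<bar> +
      \<bar>\<Sum>i\<in>I \<inter> T. \<Sum>j\<in>I - T. y $ i * H $ i $ j * x $ j\<bar>"
    using large by linarith
  moreover have "(\<Sum>i\<in>I \<inter> T. (u $ i)\<^sup>2) + (\<Sum>i\<in>I - T. (u $ i)\<^sup>2) \<le> 1" if "norm u \<le> 1" for u :: "real ^ 'k"
  proof -
    have "(\<Sum>i\<in>I \<inter> T. (u $ i)\<^sup>2) + (\<Sum>i\<in>I - T. (u $ i)\<^sup>2) = (\<Sum>i\<in>I \<inter> T \<union> (I - T). (u $ i)\<^sup>2)"
      by (subst sum.union_disjoint) auto
    also have "\<dots> \<le> (norm u)\<^sup>2" unfolding norm_vec_power2 by (intro sum_mono2) auto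
    also have "\<dots> \<le> 1" using that by (simp add: power_le_one)
    finally show ?thesis .
  qed
  from this[OF xy(1)] this[OF xy(2)] calculation show False using bound[of x y] bound[of y x] by argo
qed

section \<open>Tail bounds for random blocks\<close>

text \<open>An operator and its adjoint have the same norm: for the sum w, Cauchy-Schwarz gives
  |w|^4 \<le> |a|^2 lam |w|^2.\<close>

lemma sum_square_transpose_le:
  fixes u :: "'i \<Rightarrow> 'a::euclidean_space"
  assumes "\<And>v. (\<Sum>j\<in>J. (u j \<bullet> v)\<^sup>2) \<le> lam * (norm v)\<^sup>2"
  shows "(norm (\<Sum>j\<in>J. a j *\<^sub>R u j))\<^sup>2 \<le> lam * (\<Sum>j\<in>J. (a j)\<^sup>2)"
proof -
  define w where "w = (\<Sum>j\<in>J. a j *\<^sub>R u j)"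
  have "w \<bullet> w = (\<Sum>j\<in>J. a j * (u j \<bullet> w))"
    by (subst (1) w_def) (simp add: inner_sum_left)
  then have "(norm w)\<^sup>2 = (\<Sum>j\<in>J. a j * (u j \<bullet> w))" by (simp add: power2_norm_eq_inner)
  then have "((norm w)\<^sup>2)\<^sup>2 \<le> (\<Sum>j\<in>J. (a j)\<^sup>2) * (\<Sum>j\<in>J. (u j \<bullet> w)\<^sup>2)"
    using Cauchy_Schwarz_ineq_sum[of a "\<lambda>j. u j \<bullet> w" J] by simp
  also have "\<dots> \<le> (\<Sum>j\<in>J. (a j)\<^sup>2) * (lam * (norm w)\<^sup>2)"
    using assms by (intro mult_left_mono sum_nonneg) auto
  finally have le: "(norm w)\<^sup>2 * (norm w)\<^sup>2 \<le> (lam * (\<Sum>j\<in>J. (a j)\<^sup>2)) * (norm w)\<^sup>2"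
    by (simp add: power2_eq_square mult_ac)
  show ?thesis
  proof (cases "w = 0")
    case True
    \<comment> \<open>For w = 0 nothing can be cancelled; \<open>lam \<ge> 0\<close> then comes from
      testing the hypothesis on a unit basis vector.\<close>
    have "0 \<le> lam * (norm (SOME b::'a. b \<in> Basis))\<^sup>2"
      using assms[of "SOME b. b \<in> Basis"] by (meson order_trans sum_nonneg zero_le_power2)
    moreover have "(SOME b::'a. b \<in> Basis) \<in> Basis" by (rule someI_ex) (use nonempty_Basis in blast)
    ultimately have "0 \<le> lam" by simp
    then show ?thesis using True by (simp add: w_def[symmetric] sum_nonneg)
  next
    case False
    then show ?thesis using mult_right_le_imp_le[OF le] by (simp add: w_def[symmetric])
  qed
qed

text \<open>Given J = I - T, the squared block is a sum of independent rank-one terms over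
  \<open>I \<inter> T\<close>. Failure of all \<open>E1\<close> bounds the size of its terms,
  failure of \<open>E2\<close> its mean; both events are themselves controlled by Chernoff over J.
  Each time t = e^2 lam and t / L = l, so every application costs exp(-l) times the
  dimension.\<close>

lemma prob_cross_block_large:
  fixes H :: "real ^ 'k ^ 'k"
  assumes p: "\<And>i. p i \<in> {0..1}" and l: "0 < l" and sym: "\<And>i j. H $ i $ j = H $ j $ i"
    and entry: "\<And>i j. (H $ i $ j)\<^sup>2 \<le> 1 / (16 * l\<^sup>2)"
    and row: "\<And>i. (\<Sum>j\<in>UNIV. p j * (H $ i $ j)\<^sup>2) \<le> 1 / (16 * (exp 1)\<^sup>2 * l)"
    and WHW: "\<And>v. (\<Sum>j\<in>UNIV. p j * ((\<chi> i. sqrt (p i) * H $ i $ j) \<bullet> v)\<^sup>2) \<le> 1 / (16 * (exp 1) ^ 4) * (norm v)\<^sup>2"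
  shows "poisson_mean p UNIV (\<lambda>I. of_bool (cross_block_large H T I)) \<le> 3 * (real CARD('k) * exp (- l))"
proof -
  let ?K = "real CARD('k)"
  have p0: "0 \<le> p i" for i using p[of i] by simp
  define u where "u j = (\<chi> i. sqrt (p i) * H $ i $ j)" for j
  define E1 where "E1 i J \<longleftrightarrow> 1 / (16 * l) \<le> (\<Sum>j\<in>J. (H $ i $ j)\<^sup>2)" for i J
  define E2 where "E2 J \<longleftrightarrow> (\<exists>v. norm v = 1 \<and> 1 / (16 * (exp 1)\<^sup>2) \<le> (\<Sum>j\<in>J. (u j \<bullet> v)\<^sup>2))" for J
  have E1: "poisson_mean p (-T) (\<lambda>J. of_bool (E1 i J)) \<le> exp (- l)" for i
  proof -
    have "poisson_mean p (-T) (\<lambda>J. of_bool (E1 i J)) \<le>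
        poisson_mean p (-T) (\<lambda>J. of_bool (\<exists>v. norm v = 1 \<and> 1 / (16 * l) \<le> (\<Sum>j\<in>J. (H $ i $ j \<bullet> v)\<^sup>2)))"
      by (rule poisson_mean_mono[OF p]) (auto simp: E1_def intro!: exI[of _ 1])
    also have "\<dots> \<le> real DIM(real) * exp (- (1 / (16 * l)) / (1 / (16 * l\<^sup>2)))"
    proof (rule matrix_chernoff[OF p])
      fix v :: real
      have "(\<Sum>j\<in>-T. p j * (H $ i $ j)\<^sup>2) \<le> (\<Sum>j\<in>UNIV. p j * (H $ i $ j)\<^sup>2)"
        using p0 by (intro sum_mono2) auto
      also have "\<dots> \<le> 1 / (16 * (exp 1)\<^sup>2 * l)" by (rule row)
      finally have "(\<Sum>j\<in>-T. p j * (H $ i $ j)\<^sup>2) * v\<^sup>2 \<le> 1 / (16 * (exp 1)\<^sup>2 * l) * v\<^sup>2"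
        by (rule mult_right_mono) simp
      then show "(\<Sum>j\<in>-T. p j * (H $ i $ j \<bullet> v)\<^sup>2) \<le> 1 / (16 * (exp 1)\<^sup>2 * l) * (norm v)\<^sup>2"
        by (simp add: sum_distrib_left power_mult_distrib mult_ac)
    qed (use entry l in \<open>auto simp: divide_simps\<close>)
    also have "\<dots> = exp (- l)" using l by (simp add: power2_eq_square)
    finally show ?thesis .
  qed
  have E2: "poisson_mean p (-T) (\<lambda>J. of_bool (E2 J)) \<le> ?K * exp (- l)"
  proof -
    have "poisson_mean p (-T) (\<lambda>J. of_bool (E2 J)) \<le>
        real DIM(real ^ 'k) * exp (- (1 / (16 * (exp 1)\<^sup>2)) / (1 / (16 * (exp 1)\<^sup>2 * l)))"
      unfolding E2_def
    proof (rule matrix_chernoff[OF p])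
      fix j
      have "(norm (u j))\<^sup>2 = (\<Sum>i\<in>UNIV. p i * (H $ i $ j)\<^sup>2)"
        using p0 by (simp add: norm_vec_power2 u_def power_mult_distrib)
      also have "\<dots> = (\<Sum>i\<in>UNIV. p i * (H $ j $ i)\<^sup>2)" by (simp only: sym)
      also have "\<dots> \<le> 1 / (16 * (exp 1)\<^sup>2 * l)" by (rule row)
      finally show "(norm (u j))\<^sup>2 \<le> 1 / (16 * (exp 1)\<^sup>2 * l)" .
    next
      fix v :: "real ^ 'k"
      have "(\<Sum>j\<in>-T. p j * (u j \<bullet> v)\<^sup>2) \<le> (\<Sum>j\<in>UNIV. p j * (u j \<bullet> v)\<^sup>2)"
        using p0 by (intro sum_mono2) auto
      also have "\<dots> \<le> 1 / (16 * (exp 1) ^ 4) * (norm v)\<^sup>2" unfolding u_def by (rule WHW)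
      finally show "(\<Sum>j\<in>-T. p j * (u j \<bullet> v)\<^sup>2) \<le> 1 / (16 * (exp 1) ^ 4) * (norm v)\<^sup>2" .
    qed (use l in \<open>auto simp: divide_simps power4_eq_xxxx power2_eq_square\<close>)
    then show ?thesis using l by simp
  qed
  have inner: "poisson_mean p T (\<lambda>I. of_bool (cross_block_large H T (J \<union> I))) \<le>
      ?K * exp (- l) + (\<Sum>i\<in>UNIV. of_bool (E1 i J)) + of_bool (E2 J)" if J: "J \<subseteq> -T" for J
  \<comment> \<open>In the exceptional case the trivial bound 1 is absorbed by an indicator on the
    right.\<close>
  proof (cases "(\<exists>i. E1 i J) \<or> E2 J")
    case True
    have "poisson_mean p T (\<lambda>I. of_bool (cross_block_large H T (J \<union> I))) \<le> poisson_mean p T (\<lambda>I. 1)"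
      by (rule poisson_mean_mono[OF p]) auto
    also have "\<dots> = 1" by (simp add: poisson_mean_const)
    also have "\<dots> \<le> (\<Sum>i\<in>UNIV. of_bool (E1 i J)) + of_bool (E2 J)"
    proof (cases "E2 J")
      case False
      then obtain i where "E1 i J" using True by blast
      then have "1 \<le> (\<Sum>i\<in>UNIV. of_bool (E1 i J) :: real)"
        using member_le_sum[of i UNIV "\<lambda>i. of_bool (E1 i J) :: real"] by simp
      then show ?thesis by simp
    qed (simp add: sum_nonneg)
    finally show ?thesis by (simp add: add.assoc add_increasing)
  next
    case False
    define h where "h i = (\<chi> j. if j \<in> J then H $ i $ j else 0)" for i
    have "poisson_mean p T (\<lambda>I. of_bool (cross_block_large H T (J \<union> I))) =
        poisson_mean p T (\<lambda>I. of_bool (\<exists>v. norm v = 1 \<and> 1 / 16 \<le> (\<Sum>i\<in>I. (h i \<bullet> v)\<^sup>2)))"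
    proof (rule poisson_mean_cong)
      fix I assume "I \<subseteq> T"
      then have "(J \<union> I) \<inter> T = I" "J \<union> I - T = J" using J by auto
      then show "of_bool (cross_block_large H T (J \<union> I)) =
          of_bool (\<exists>v. norm v = 1 \<and> 1 / 16 \<le> (\<Sum>i\<in>I. (h i \<bullet> v)\<^sup>2))"
        unfolding cross_block_large_def h_def by simp
    qed
    also have "\<dots> \<le> real DIM(real ^ 'k) * exp (- (1 / 16) / (1 / (16 * l)))"
    proof (rule matrix_chernoff[OF p])
      fix i
      show "(norm (h i))\<^sup>2 \<le> 1 / (16 * l)"
        using False norm_restrict_power2[of J "H $ i"] by (auto simp: h_def E1_def not_le less_imp_le)
    next
      fix v :: "real ^ 'k"
      have u: "(\<Sum>j\<in>J. (u j \<bullet> w)\<^sup>2) \<le> 1 / (16 * (exp 1)\<^sup>2) * (norm w)\<^sup>2" for w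
        by (rule sum_square_inner_le_homogeneous) (use False in \<open>auto simp: E2_def not_le\<close>)
      have "(\<Sum>i\<in>T. p i * (h i \<bullet> v)\<^sup>2) \<le> (\<Sum>i\<in>UNIV. p i * (h i \<bullet> v)\<^sup>2)"
        using p0 by (intro sum_mono2) auto
      \<comment> \<open>The weighted form in the rows is the squared norm of W H restricted to the
        columns in J, applied to v; failure of \<open>E2\<close> bounds the adjoint of this
        operator.\<close>
      also have "\<dots> = (norm (\<Sum>j\<in>J. v $ j *\<^sub>R u j))\<^sup>2"
        unfolding norm_vec_power2
      proof (intro sum.cong refl)
        fix i
        have "h i \<bullet> v = (\<Sum>j\<in>J. H $ i $ j * v $ j)"
          unfolding h_def inner_vec_def by (intro sum.mono_neutral_cong_right) auto
        then have "(\<Sum>j\<in>J. v $ j *\<^sub>R u j) $ i = sqrt (p i) * (h i \<bullet> v)"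
          by (simp add: u_def sum_distrib_left mult_ac)
        then show "p i * (h i \<bullet> v)\<^sup>2 = ((\<Sum>j\<in>J. v $ j *\<^sub>R u j) $ i)\<^sup>2"
          using p0[of i] by (simp add: power_mult_distrib)
      qed
      also have "\<dots> \<le> 1 / (16 * (exp 1)\<^sup>2) * (\<Sum>j\<in>J. (v $ j)\<^sup>2)"
        by (rule sum_square_transpose_le[OF u])
      also have "\<dots> \<le> 1 / (16 * (exp 1)\<^sup>2) * (norm v)\<^sup>2"
        unfolding norm_vec_power2 by (intro mult_left_mono sum_mono2) auto
      finally show "(\<Sum>i\<in>T. p i * (h i \<bullet> v)\<^sup>2) \<le> 1 / (16 * (exp 1)\<^sup>2) * (norm v)\<^sup>2" .
    qed (use l in auto)
    also have "\<dots> = ?K * exp (- l)" using l by simp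
    finally show ?thesis by (simp add: add_increasing2 sum_nonneg add.assoc)
  qed
  have "poisson_mean p UNIV (\<lambda>I. of_bool (cross_block_large H T I)) =
      poisson_mean p (-T) (\<lambda>J. poisson_mean p T (\<lambda>I. of_bool (cross_block_large H T (J \<union> I))))"
    using poisson_mean_union[of "-T" T p] by simp
  also have "\<dots> \<le> poisson_mean p (-T) (\<lambda>J. ?K * exp (- l) + (\<Sum>i\<in>UNIV. of_bool (E1 i J)) + of_bool (E2 J))"
    by (rule poisson_mean_mono[OF p inner])
  also have "\<dots> = ?K * exp (- l) + (\<Sum>i\<in>UNIV. poisson_mean p (-T) (\<lambda>J. of_bool (E1 i J))) +
      poisson_mean p (-T) (\<lambda>J. of_bool (E2 J))"
    unfolding poisson_mean_add poisson_mean_sum by (simp add: poisson_mean_const)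
  also have "\<dots> \<le> ?K * exp (- l) + (\<Sum>i\<in>(UNIV :: 'k set). exp (- l)) + ?K * exp (- l)"
    by (intro add_mono sum_mono E1 E2 order_refl)
  finally show ?thesis by simp
qed

text \<open>At least a quarter of all cuts witness a large submatrix, so its probability is at most
  4 times the average over cuts of the bound 3 K exp(-l).\<close>

lemma prob_submatrix_large:
  fixes H :: "real ^ 'k ^ 'k"
  assumes p: "\<And>i. p i \<in> {0..1}" and l: "0 < l"
    and sym: "\<And>i j. H $ i $ j = H $ j $ i" and hollow: "\<And>i. H $ i $ i = 0"
    and entry: "\<And>i j. (H $ i $ j)\<^sup>2 \<le> 1 / (16 * l\<^sup>2)"
    and row: "\<And>i. (\<Sum>j\<in>UNIV. p j * (H $ i $ j)\<^sup>2) \<le> 1 / (16 * (exp 1)\<^sup>2 * l)"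
    and WHW: "\<And>v. (\<Sum>j\<in>UNIV. p j * ((\<chi> i. sqrt (p i) * H $ i $ j) \<bullet> v)\<^sup>2) \<le> 1 / (16 * (exp 1) ^ 4) * (norm v)\<^sup>2"
  shows "poisson_mean p UNIV (\<lambda>I. of_bool (submatrix_large H I)) \<le> 12 * (real CARD('k) * exp (- l))"
proof -
  have decouple: "2 ^ CARD('k) * of_bool (submatrix_large H I) \<le>
      4 * (\<Sum>T\<in>UNIV. of_bool (cross_block_large H T I) :: real)" for I
  proof (cases "submatrix_large H I")
    case True
    have "2 ^ CARD('k) \<le> 4 * real (card {T. cross_block_large H T I})"
      using cross_form_often_large[OF hollow True]
    proof (rule order_trans)
      have "{T. \<exists>x y. norm x \<le> 1 \<and> norm y \<le> 1 \<and> 4 / 15 \<le>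
          \<bar>(\<Sum>i\<in>I \<inter> T. \<Sum>j\<in>I - T. x $ i * H $ i $ j * y $ j) +
          (\<Sum>i\<in>I - T. \<Sum>j\<in>I \<inter> T. x $ i * H $ i $ j * y $ j)\<bar>} \<subseteq> {T. cross_block_large H T I}"
        using cross_block_large_if_form_large[OF sym] by blast
      then show "4 * real (card {T. \<exists>x y. norm x \<le> 1 \<and> norm y \<le> 1 \<and> 4 / 15 \<le>
          \<bar>(\<Sum>i\<in>I \<inter> T. \<Sum>j\<in>I - T. x $ i * H $ i $ j * y $ j) +
          (\<Sum>i\<in>I - T. \<Sum>j\<in>I \<inter> T. x $ i * H $ i $ j * y $ j)\<bar>}) \<le> 4 * real (card {T. cross_block_large H T I})"
        by (simp add: card_mono)
    qed
    then show ?thesis using True by simp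
  qed (simp add: sum_nonneg)
  have "2 ^ CARD('k) * poisson_mean p UNIV (\<lambda>I. of_bool (submatrix_large H I)) \<le>
      4 * (\<Sum>T\<in>UNIV. poisson_mean p UNIV (\<lambda>I. of_bool (cross_block_large H T I)))"
    unfolding poisson_mean_cmult[symmetric] poisson_mean_sum[symmetric]
    by (rule poisson_mean_mono[OF p decouple])
  also have "\<dots> \<le> 4 * (\<Sum>T\<in>(UNIV :: 'k set set). 3 * (real CARD('k) * exp (- l)))"
    by (intro mult_left_mono sum_mono prob_cross_block_large p l sym entry row WHW) auto
  also have "\<dots> = 2 ^ CARD('k) * (12 * (real CARD('k) * exp (- l)))" by (simp add: card_UNIV_set)
  finally show ?thesis by simp
qed

section \<open>Recovery by orthogonal matching pursuit\<close>

lemma hollow_gram_component: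
  "hollow_gram \<Phi> $ i $ j = column i \<Phi> \<bullet> column j \<Phi> - (if i = j then 1 else 0)"
  by (simp add: hollow_gram_def matrix_matrix_mult_def transpose_def column_def inner_vec_def mat_def)

text \<open>Coefficients are attached to indices rather than vectors, so coinciding atoms need no
  separate treatment.\<close>

lemma span_image_sum:
  assumes "finite J" "v \<in> span (f ` J)"
  shows "\<exists>a. v = (\<Sum>j\<in>J. a j *\<^sub>R f j)"
  using assms(2)
proof (induction rule: span_induct_alt)
  case base
  show ?case by (rule exI[of _ "\<lambda>_. 0"]) simp
next
  case (step c x y)
  then obtain j a where j: "j \<in> J" "x = f j" and y: "y = (\<Sum>j\<in>J. a j *\<^sub>R f j)" by blast
  have "c *\<^sub>R x = (\<Sum>i\<in>J. (if i = j then c else 0) *\<^sub>R f i)"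
  proof -
    have "(\<Sum>i\<in>J. (if i = j then c else 0) *\<^sub>R f i) = (\<Sum>i\<in>J. if i = j then c *\<^sub>R f i else 0)"
      by (intro sum.cong) auto
    then show ?thesis using assms(1) j by simp
  qed
  then have "c *\<^sub>R x + y = (\<Sum>i\<in>J. ((if i = j then c else 0) + a i) *\<^sub>R f i)"
    by (simp add: y scaleR_add_left sum.distrib)
  then show ?case by (rule exI[of _ "\<lambda>i. (if i = j then c else 0) + a i"])
qed

lemma submatrix_small_bilinear:
  fixes H :: "real ^ 'k ^ 'k"
  assumes "\<not> submatrix_large H I"
  shows "\<bar>\<Sum>i\<in>I. \<Sum>j\<in>I. u $ i * H $ i $ j * v $ j\<bar> \<le> 4 / 5 * norm u * norm v"
proof (cases "u = 0 \<or> v = 0")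
  case False
  define u' v' where "u' = u /\<^sub>R norm u" and "v' = v /\<^sub>R norm v"
  have n: "norm u' \<le> 1" "norm v' \<le> 1" using False by (simp_all add: u'_def v'_def)
  have "\<bar>\<Sum>i\<in>I. \<Sum>j\<in>I. u' $ i * H $ i $ j * v' $ j\<bar> < 4 / 5"
    by (rule ccontr) (use assms n in \<open>auto simp: submatrix_large_def not_less\<close>)
  moreover have "(\<Sum>i\<in>I. \<Sum>j\<in>I. u' $ i * H $ i $ j * v' $ j) =
      (\<Sum>i\<in>I. \<Sum>j\<in>I. u $ i * H $ i $ j * v $ j) / (norm u * norm v)"
    by (simp add: u'_def v'_def sum_divide_distrib sum_distrib_left divide_inverse mult_ac)
  ultimately show ?thesis using False by (simp add: abs_div_pos[symmetric] divide_less_eq mult.assoc)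
qed auto

section \<open>Selection steps of the pursuit\<close>

text \<open>The residual is a combination of support atoms with coefficients z, equal to
  \<open>x\<close> off \<open>J\<close>. Orthogonality to the selected atoms bounds z on
  \<open>J\<close>; then the short rows of H keep every inner product with the residual close to the
  coefficient itself.\<close>

lemma omp_selects_from_support:
  fixes \<Phi> :: "real ^ 'k ^ 'd"
  assumes small: "\<not> submatrix_large (hollow_gram \<Phi>) I"
    and rows: "\<And>k. (\<Sum>j\<in>I. (hollow_gram \<Phi> $ k $ j)\<^sup>2) \<le> t"
    and J: "J \<subseteq> I" and i: "i \<in> I - J" "x i \<noteq> 0" and t: "16 * t * (\<Sum>l\<in>I - J. (x l)\<^sup>2) \<le> (x i)\<^sup>2"
    and y: "y = (\<Sum>l\<in>I. x l *\<^sub>R column l \<Phi>)"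
    and r: "r = y - proj_mat (submat_cols \<Phi> J) *v y"
    and k: "is_arg_max (\<lambda>k. \<bar>column k \<Phi> \<bullet> r\<bar>) (\<lambda>_. True) k"
  shows "k \<in> I - J"
proof -
  let ?H = "hollow_gram \<Phi>"
  have "proj_mat (submat_cols \<Phi> J) *v y \<in> span ((\<lambda>j. column j \<Phi>) ` J)"
    using proj_mat_in_span[of "submat_cols \<Phi> J" y] by (simp only: span_columns_submat_cols)
  then obtain a where a: "proj_mat (submat_cols \<Phi> J) *v y = (\<Sum>j\<in>J. a j *\<^sub>R column j \<Phi>)"
    using span_image_sum[OF finite] by blast
  define z where "z = (\<chi> l. if l \<in> I then x l - (if l \<in> J then a l else 0) else 0)"
  have z: "z $ l = x l" if "l \<in> I - J" for l using that by (simp add: z_def)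
  have "proj_mat (submat_cols \<Phi> J) *v y = (\<Sum>l\<in>I. (if l \<in> J then a l else 0) *\<^sub>R column l \<Phi>)"
    unfolding a using J by (intro sum.mono_neutral_cong_left) auto
  then have rz: "r = (\<Sum>l\<in>I. z $ l *\<^sub>R column l \<Phi>)"
    by (simp add: r y z_def scaleR_diff_left sum_subtractf)
  have inner: "column l \<Phi> \<bullet> r = (\<Sum>m\<in>I. ?H $ l $ m * z $ m) + z $ l" for l
  proof -
    have "column l \<Phi> \<bullet> r = (\<Sum>m\<in>I. ?H $ l $ m * z $ m + (if l = m then z $ m else 0))"
      unfolding rz inner_sum_right
      by (intro sum.cong refl) (simp add: hollow_gram_component algebra_simps)
    also have "\<dots> = (\<Sum>m\<in>I. ?H $ l $ m * z $ m) + (if l \<in> I then z $ l else 0)"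
      by (simp add: sum.distrib)
    finally show ?thesis by (simp add: z_def)
  qed
  have orth: "column l \<Phi> \<bullet> r = 0" if "l \<in> J" for l
    unfolding r
  proof (rule proj_mat_residual_orthogonal)
    show "column l \<Phi> \<in> span (columns (submat_cols \<Phi> J))"
      unfolding span_columns_submat_cols using that by (intro span_base) auto
  qed
  define u where "u = (\<chi> l. if l \<in> J then z $ l else 0)"
  define X where "X = (\<Sum>l\<in>I - J. (x l)\<^sup>2)"
  have u2: "(norm u)\<^sup>2 = (\<Sum>l\<in>J. (z $ l)\<^sup>2)" unfolding u_def by (rule norm_restrict_power2)
  have z2: "(norm z)\<^sup>2 = (norm u)\<^sup>2 + X"
  proof -
    have "(norm z)\<^sup>2 = (\<Sum>l\<in>J \<union> (I - J). (z $ l)\<^sup>2)"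
      unfolding norm_vec_power2 using J
      by (intro sum.mono_neutral_right) (auto simp: z_def)
    also have "\<dots> = (\<Sum>l\<in>J. (z $ l)\<^sup>2) + (\<Sum>l\<in>I - J. (z $ l)\<^sup>2)" by (intro sum.union_disjoint) auto
    finally show ?thesis by (simp add: u2 X_def z)
  qed
  \<comment> \<open>Orthogonality says (H z)_l = -z_l on \<open>J\<close>; pairing with u gives
    |u|^2 = -<u, H z>. With |z|^2 = |u|^2 + X this yields |z|^2 \<le> X / (1 - 16/25) = 25/9
    X.\<close>
  have "(norm u)\<^sup>2 \<le> 4 / 5 * norm u * norm z"
  proof -
    have "0 = (\<Sum>l\<in>J. z $ l * (column l \<Phi> \<bullet> r))" using orth by simp
    also have "\<dots> = (\<Sum>l\<in>J. \<Sum>m\<in>I. z $ l * ?H $ l $ m * z $ m) + (norm u)\<^sup>2"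
      unfolding inner u2 by (simp add: distrib_left sum.distrib sum_distrib_left power2_eq_square mult.assoc)
    also have "(\<Sum>l\<in>J. \<Sum>m\<in>I. z $ l * ?H $ l $ m * z $ m) = (\<Sum>l\<in>I. \<Sum>m\<in>I. u $ l * ?H $ l $ m * z $ m)"
      using J by (intro sum.mono_neutral_cong_left) (auto simp: u_def)
    finally show ?thesis using submatrix_small_bilinear[OF small, of u z] by linarith
  qed
  then have "norm u \<le> 4 / 5 * norm z"
    by (cases "norm u = 0") (simp_all add: power2_eq_square)
  then have "(norm u)\<^sup>2 \<le> (4 / 5 * norm z)\<^sup>2" by (intro power_mono) auto
  then have zX: "(norm z)\<^sup>2 \<le> 25 / 9 * X" using z2 by (simp add: power_mult_distrib power2_eq_square)
  have t0: "0 \<le> t" using rows[of i] by (meson order_trans sum_nonneg zero_le_power2)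
  \<comment> \<open>The constant is 5/12 = 5/3 * 1/4: a factor 25/9 from z and 1/16 from the
    hypothesis on \<open>t\<close>, under the square root.\<close>
  have bound: "\<bar>\<Sum>m\<in>I. ?H $ l $ m * z $ m\<bar> \<le> 5 / 12 * \<bar>x i\<bar>" for l
  proof -
    have "(\<Sum>m\<in>I. ?H $ l $ m * z $ m)\<^sup>2 \<le> (\<Sum>m\<in>I. (?H $ l $ m)\<^sup>2) * (\<Sum>m\<in>I. (z $ m)\<^sup>2)"
      by (rule Cauchy_Schwarz_ineq_sum)
    also have "\<dots> \<le> t * (norm z)\<^sup>2"
      unfolding norm_vec_power2 by (intro mult_mono rows sum_mono2 sum_nonneg t0) auto
    also have "\<dots> \<le> t * (25 / 9 * X)" using zX t0 by (rule mult_left_mono)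
    also have "\<dots> \<le> (5 / 12 * \<bar>x i\<bar>)\<^sup>2" using t by (simp add: X_def power_mult_distrib power2_eq_square)
    finally show ?thesis by (simp add: abs_le_square_iff[symmetric])
  qed
  have "\<bar>column i \<Phi> \<bullet> r\<bar> \<le> \<bar>column k \<Phi> \<bullet> r\<bar>"
    using k by (auto simp: is_arg_max_def not_less)
  \<comment> \<open>Index \<open>i\<close> scores at least 7/12 |x i|, atoms off the support at most
    5/12 |x i| and selected atoms 0, so every maximiser lies in \<open>I - J\<close>.\<close>
  moreover have "\<bar>column i \<Phi> \<bullet> r\<bar> \<ge> \<bar>x i\<bar> - 5 / 12 * \<bar>x i\<bar>"
    using bound[of i] z[OF i(1)] unfolding inner by linarith
  ultimately have gt: "\<bar>column k \<Phi> \<bullet> r\<bar> > 5 / 12 * \<bar>x i\<bar>" using i(2) by linarith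
  have "k \<notin> J" using gt orth[of k] i(2) by auto
  moreover have "k \<in> I"
  proof (rule ccontr)
    assume "k \<notin> I"
    then have "column k \<Phi> \<bullet> r = (\<Sum>m\<in>I. ?H $ k $ m * z $ m)" by (simp add: inner z_def)
    then show False using bound[of k] gt by simp
  qed
  ultimately show ?thesis by simp
qed

lemma omp_recovers_support:
  fixes \<Phi> :: "real ^ 'k ^ 'd"
  assumes small: "\<not> submatrix_large (hollow_gram \<Phi>) I"
    and rows: "\<And>k. (\<Sum>j\<in>I. (hollow_gram \<Phi> $ k $ j)\<^sup>2) \<le> t"
    and t: "\<And>J. J \<subset> I \<Longrightarrow> \<exists>i\<in>I - J. x i \<noteq> 0 \<and> 16 * t * (\<Sum>l\<in>I - J. (x l)\<^sup>2) \<le> (x i)\<^sup>2"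
  shows "omp_recovers \<Phi> (\<Sum>l\<in>I. x l *\<^sub>R column l \<Phi>) (card I) I"
  unfolding omp_recovers_def
proof (intro allI impI)
  fix j J r
  define y where "y = (\<Sum>l\<in>I. x l *\<^sub>R column l \<Phi>)"
  assume "omp_run \<Phi> (\<Sum>l\<in>I. x l *\<^sub>R column l \<Phi>) j J r"
  then have r0: "r 0 = y" and J0: "J 0 = {}"
    and arg: "\<And>i. is_arg_max (\<lambda>k. \<bar>column k \<Phi> \<bullet> r i\<bar>) (\<lambda>_. True) (j i)"
    and J: "\<And>i. J (Suc i) = J i \<union> {j i}"
    and r: "\<And>i. r (Suc i) = y - proj_mat (submat_cols \<Phi> (J (Suc i))) *v y"
    by (auto simp: omp_run_def y_def)
  \<comment> \<open>Hence the initial residual has the same form as the later ones.\<close>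
  have "proj_mat (submat_cols \<Phi> {}) *v y = 0"
    using proj_mat_in_span[of "submat_cols \<Phi> {}" y] unfolding span_columns_submat_cols by simp
  then have rr: "r i = y - proj_mat (submat_cols \<Phi> (J i)) *v y" for i
    using r r0 J0 by (cases i) auto
  have step: "j n \<in> I - J n" if Jn: "J n \<subseteq> I" "card (J n) = n" "n < card I" for n
  proof -
    have "J n \<subset> I" using Jn by auto
    then obtain i where "i \<in> I - J n" "x i \<noteq> 0" "16 * t * (\<Sum>l\<in>I - J n. (x l)\<^sup>2) \<le> (x i)\<^sup>2"
      using t by blast
    then show ?thesis
      by (rule omp_selects_from_support[OF small rows Jn(1) _ _ _ y_def rr arg])
  qed
  have inv: "J n \<subseteq> I \<and> card (J n) = n" if "n \<le> card I" for n
    using that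
  proof (induction n)
    case (Suc n)
    then have Jn: "J n \<subseteq> I" "card (J n) = n" "n < card I" by auto
    show ?case using step[OF Jn] Jn by (auto simp: J card_insert_if)
  qed (simp add: J0)
  have "J (card I) = I" using inv[of "card I"] by (intro card_subset_eq) auto
  moreover have "j i \<in> I - J i" if "i < card I" for i
    using that inv[of i] by (intro step) auto
  ultimately show "(\<forall>i<card I. j i \<in> I - J i) \<and> J (card I) = I" by blast
qed

section \<open>The matrix norms of the hypotheses in coordinates\<close>

text \<open>Unit atoms make the diagonal entries zero, which the inserted 0 in
  \<open>coherence\<close> covers.\<close>

lemma abs_hollow_gram_le_coherence:
  assumes "\<And>k. norm (column k \<Phi>) = 1"
  shows "\<bar>hollow_gram \<Phi> $ i $ j\<bar> \<le> coherence \<Phi>"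
proof -
  have "finite {\<bar>column i \<Phi> \<bullet> column j \<Phi>\<bar> | i j. i \<noteq> j}"
    by (rule finite_subset[of _ "range (\<lambda>(i, j). \<bar>column i \<Phi> \<bullet> column j \<Phi>\<bar>)"]) auto
  then show ?thesis
    unfolding coherence_def using assms
    by (intro Max_ge) (auto simp: hollow_gram_component dot_square_norm)
qed

lemma matrix_mult_weight_matrix:
  "(A ** weight_matrix p) $ i $ j = A $ i $ j * sqrt (p j)"
  by (simp add: matrix_matrix_mult_def weight_matrix_def if_distrib cong: if_cong)

lemma weight_matrix_mult:
  "(weight_matrix p ** A) $ i $ j = sqrt (p i) * A $ i $ j"
  by (simp add: matrix_matrix_mult_def weight_matrix_def if_distrib[of "\<lambda>x. x * _"] cong: if_cong)

lemma weighted_row_le_norm_inf_2: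
  assumes "\<And>j. 0 \<le> p j"
  shows "(\<Sum>j\<in>UNIV. p j * (A $ i $ j)\<^sup>2) \<le> (norm_inf_2 (A ** weight_matrix p))\<^sup>2"
proof -
  have "(\<Sum>j\<in>UNIV. p j * (A $ i $ j)\<^sup>2) = (norm (row i (A ** weight_matrix p)))\<^sup>2"
    using assms by (simp add: norm_vec_power2 row_def matrix_mult_weight_matrix power_mult_distrib mult.commute)
  also have "\<dots> \<le> (norm_inf_2 (A ** weight_matrix p))\<^sup>2"
    unfolding norm_inf_2_def by (intro power_mono Max_ge) auto
  finally show ?thesis .
qed

text \<open>The left side is |W A W v|^2 written out by coordinates, symmetry exchanging rows and
  columns of \<open>A\<close>.\<close>

lemma weighted_form_le_norm_2_2:
  fixes A :: "real ^ 'k ^ 'k"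
  assumes sym: "\<And>i j. A $ i $ j = A $ j $ i" and p: "\<And>j. 0 \<le> p j"
  shows "(\<Sum>j\<in>UNIV. p j * ((\<chi> i. sqrt (p i) * A $ i $ j) \<bullet> v)\<^sup>2) \<le>
    (norm_2_2 (weight_matrix p ** A ** weight_matrix p))\<^sup>2 * (norm v)\<^sup>2"
proof -
  let ?M = "weight_matrix p ** A ** weight_matrix p"
  have "(?M *v v) $ j = sqrt (p j) * ((\<chi> i. sqrt (p i) * A $ i $ j) \<bullet> v)" for j
    by (simp add: matrix_vector_mult_def inner_vec_def matrix_mult_weight_matrix weight_matrix_mult
        sum_distrib_left mult_ac sym[of j])
  then have "(\<Sum>j\<in>UNIV. p j * ((\<chi> i. sqrt (p i) * A $ i $ j) \<bullet> v)\<^sup>2) = (norm (?M *v v))\<^sup>2"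
    using p by (simp add: norm_vec_power2 power_mult_distrib)
  also have "\<dots> \<le> (norm_2_2 ?M * norm v)\<^sup>2"
    unfolding norm_2_2_def by (intro power_mono onorm) auto
  finally show ?thesis by (simp add: power_mult_distrib)
qed

lemma Linf_set_L2_set_pos:
  fixes c :: "nat \<Rightarrow> real"
  assumes "finite L" "L \<noteq> {}" "\<And>k. k \<in> L \<Longrightarrow> 0 < c k"
  shows "0 < Linf_set c L" "0 < L2_set c L" "\<exists>k\<in>L. Linf_set c L = c k"
proof -
  have "Linf_set c L \<in> (\<lambda>k. \<bar>c k\<bar>) ` L" unfolding Linf_set_def using assms by (intro Max_in) auto
  then show max: "\<exists>k\<in>L. Linf_set c L = c k" using assms(3) by fastforce
  then show "0 < Linf_set c L" using assms(3) by auto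
  show "0 < L2_set c L"
    unfolding L2_set_def using assms by (auto intro!: sum_pos simp: less_imp_neq[symmetric])
qed

theorem theorem11:
  fixes \<Phi> :: "real ^ 'k ^ 'd" and p :: "'k \<Rightarrow> real" and S :: nat
    and c :: "nat \<Rightarrow> real" and e :: "'k set \<Rightarrow> nat \<Rightarrow> 'k" and \<epsilon> :: real
  assumes unit_norm: "\<And>k. norm (column k \<Phi>) = 1"
    and S_pos: "S > 0"
    and p_range: "\<And>i. p i \<in> {0..1}"
    and p_sum: "(\<Sum>i\<in>UNIV. p i) = real S"
    and c_pos: "\<And>k. k \<in> {1..S} \<Longrightarrow> c k > 0"
    and enum: "\<And>I. card I = S \<Longrightarrow> bij_betw (e I) {1..S} I"
    and eps: "\<epsilon> \<in> {0<..<1}"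
    and WHW: "norm_2_2 (weight_matrix p ** hollow_gram \<Phi> ** weight_matrix p) \<le> 1 / (4 * (exp 1)\<^sup>2)"
    and HW: "(norm_inf_2 (hollow_gram \<Phi> ** weight_matrix p))\<^sup>2 \<le>
      min (MIN L\<in>{L. L \<noteq> {} \<and> L \<subseteq> {1..S}}. (Linf_set c L)\<^sup>2 / (16 * (exp 1)\<^sup>2 * (L2_set c L)\<^sup>2))
          (1 / (16 * (exp 1)\<^sup>2 * ln (218 * real CARD('k) / \<epsilon>)))"
    and mu: "coherence \<Phi> \<le>
      min (MIN L\<in>{L. L \<noteq> {} \<and> L \<subseteq> {1..S}}.
             Linf_set c L / (4 * L2_set c L * sqrt (ln (218 * real CARD('k) / \<epsilon>))))
          (1 / (4 * ln (218 * real CARD('k) / \<epsilon>)))"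
  shows "measure_pmf.prob (pair_pmf (rejective_sampling p S) (rademacher_signs S))
           {(I, \<sigma>). omp_recovers \<Phi> (signal \<Phi> S c e I \<sigma>) S I} \<ge> 1 - \<epsilon>"
proof -
  define H where "H = hollow_gram \<Phi>"
  define l where "l = ln (218 * real CARD('k) / \<epsilon>)"
  define \<L> where "\<L> = {L. L \<noteq> {} \<and> L \<subseteq> {1..S}}"
  define q where "q L = (Linf_set c L)\<^sup>2 / (16 * (exp 1)\<^sup>2 * (L2_set c L)\<^sup>2)" for L
  \<comment> \<open>The factor e^2 is the gap between mean and threshold that
    \<open>matrix_chernoff\<close> requires; it cancels the one in \<open>q\<close>.\<close>
  define t where "t = (exp 1)\<^sup>2 * (MIN L\<in>\<L>. q L)"
  define bad where "bad I \<longleftrightarrow> submatrix_large H I \<or> (\<exists>k. t \<le> (\<Sum>j\<in>I. (H $ k $ j)\<^sup>2))" for I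
  have p0: "0 \<le> p i" for i using p_range[of i] by simp
  have K: "1 \<le> real CARD('k)" by (simp add: Suc_leI)
  have "\<epsilon> < 218 * real CARD('k)" using eps K unfolding greaterThanLessThan_iff by linarith
  then have "1 < 218 * real CARD('k) / \<epsilon>" using eps by simp
  then have l: "0 < l" and exp_l: "exp (- l) = \<epsilon> / (218 * real CARD('k))"
    by (simp_all add: l_def exp_minus)
  have sym: "H $ i $ j = H $ j $ i" for i j by (simp add: H_def hollow_gram_component inner_commute)
  have hollow: "H $ i $ i = 0" for i
    using unit_norm by (simp add: H_def hollow_gram_component dot_square_norm)
  have coh: "\<bar>H $ i $ j\<bar> \<le> coherence \<Phi>" for i j
    unfolding H_def by (rule abs_hollow_gram_le_coherence[OF unit_norm])
  have row: "(\<Sum>j\<in>UNIV. p j * (H $ i $ j)\<^sup>2) \<le> (norm_inf_2 (H ** weight_matrix p))\<^sup>2" for i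
    by (rule weighted_row_le_norm_inf_2[OF p0])
  have fin: "finite \<L>" and ne: "{1..S} \<in> \<L>" using S_pos by (auto simp: \<L>_def)
  have cL: "0 < Linf_set c L" "0 < L2_set c L" "\<exists>k\<in>L. Linf_set c L = c k" if "L \<in> \<L>" for L
    using that c_pos by (intro Linf_set_L2_set_pos; auto simp: \<L>_def intro: finite_subset)+
  have tL: "16 * t * (L2_set c L)\<^sup>2 \<le> (Linf_set c L)\<^sup>2" if L: "L \<in> \<L>" for L
  proof -
    have "t \<le> (exp 1)\<^sup>2 * q L" unfolding t_def using fin L by (intro mult_left_mono Min_le) auto
    then show ?thesis using cL(2)[OF L] by (simp add: q_def field_simps)
  qed
  \<comment> \<open>At a minimiser of \<open>q\<close> the coherence condition reads \<mu>^2 \<le> t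
    / l, so one \<open>t\<close> serves both hypotheses.\<close>
  obtain L0 where L0: "L0 \<in> \<L>" "t = (exp 1)\<^sup>2 * q L0"
  proof -
    have "(MIN L\<in>\<L>. q L) \<in> q ` \<L>" using fin ne by (intro Min_in) auto
    then show thesis using that by (auto simp: t_def)
  qed
  have t_eq: "t = (Linf_set c L0 / (4 * L2_set c L0))\<^sup>2"
    unfolding L0(2) q_def by (simp add: power_divide power_mult_distrib)
  have t0: "0 < t" unfolding t_eq using cL[OF L0(1)] by simp
  have entry1: "(H $ i $ j)\<^sup>2 \<le> 1 / (16 * l\<^sup>2)" for i j
  proof -
    have "\<bar>H $ i $ j\<bar> \<le> 1 / (4 * l)" using coh[of i j] mu by (simp add: l_def)
    then have "\<bar>H $ i $ j\<bar>\<^sup>2 \<le> (1 / (4 * l))\<^sup>2" by (intro power_mono) auto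
    then show ?thesis by (simp add: power_divide power_mult_distrib)
  qed
  have entry2: "(H $ i $ j)\<^sup>2 \<le> t / l" for i j
  proof -
    have "(MIN L\<in>\<L>. Linf_set c L / (4 * L2_set c L * sqrt l)) \<le> Linf_set c L0 / (4 * L2_set c L0 * sqrt l)"
      using fin L0(1) by (intro Min_le) auto
    then have "\<bar>H $ i $ j\<bar> \<le> Linf_set c L0 / (4 * L2_set c L0 * sqrt l)"
      using coh[of i j] mu by (simp add: l_def \<L>_def)
    then have "\<bar>H $ i $ j\<bar>\<^sup>2 \<le> (Linf_set c L0 / (4 * L2_set c L0 * sqrt l))\<^sup>2" by (intro power_mono) auto
    also have "\<dots> = t / l" unfolding t_eq using l by (simp add: power_divide power_mult_distrib)
    finally show ?thesis by simp
  qed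
  have row1: "(\<Sum>j\<in>UNIV. p j * (H $ i $ j)\<^sup>2) \<le> 1 / (16 * (exp 1)\<^sup>2 * l)" for i
    using row[of i] HW by (simp add: H_def l_def)
  have row2: "(\<Sum>j\<in>UNIV. p j * (H $ i $ j)\<^sup>2) \<le> t / (exp 1)\<^sup>2" for i
    using row[of i] HW by (simp add: H_def t_def q_def \<L>_def)
  have WHW': "(\<Sum>j\<in>UNIV. p j * ((\<chi> i. sqrt (p i) * H $ i $ j) \<bullet> v)\<^sup>2) \<le> 1 / (16 * (exp 1) ^ 4) * (norm v)\<^sup>2" for v
  proof -
    let ?n = "norm_2_2 (weight_matrix p ** H ** weight_matrix p)"
    have "0 \<le> ?n" unfolding norm_2_2_def by (intro onorm_pos_le) simp
    then have "?n\<^sup>2 \<le> (1 / (4 * (exp 1)\<^sup>2))\<^sup>2" using WHW by (intro power_mono) (auto simp: H_def)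
    also have "\<dots> = 1 / (16 * (exp 1) ^ 4)" by (simp add: power_divide power_mult_distrib)
    finally have "?n\<^sup>2 * (norm v)\<^sup>2 \<le> 1 / (16 * (exp 1) ^ 4) * (norm v)\<^sup>2" by (intro mult_right_mono) auto
    then show ?thesis using weighted_form_le_norm_2_2[where p = p and v = v, OF sym p0] by linarith
  qed
  have bad_row: "poisson_mean p UNIV (\<lambda>I. of_bool (t \<le> (\<Sum>j\<in>I. (H $ k $ j)\<^sup>2))) \<le> exp (- l)" for k
  proof -
    have "poisson_mean p UNIV (\<lambda>I. of_bool (t \<le> (\<Sum>j\<in>I. (H $ k $ j)\<^sup>2))) \<le>
        poisson_mean p UNIV (\<lambda>I. of_bool (\<exists>v. norm v = 1 \<and> t \<le> (\<Sum>j\<in>I. (H $ k $ j \<bullet> v)\<^sup>2)))"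
      by (rule poisson_mean_mono[OF p_range]) (auto intro!: exI[of _ 1])
    \<comment> \<open>Scalar Chernoff for the squared entries of row \<open>k\<close>, with L = t /
      l and lam = t / e^2; the exponent t / L is l.\<close>
    also have "\<dots> \<le> real DIM(real) * exp (- t / (t / l))"
    proof (rule matrix_chernoff[OF p_range])
      fix v :: real
      have "(\<Sum>j\<in>UNIV. p j * (H $ k $ j)\<^sup>2) * v\<^sup>2 \<le> t / (exp 1)\<^sup>2 * v\<^sup>2"
        using row2 by (rule mult_right_mono) simp
      then show "(\<Sum>j\<in>UNIV. p j * (H $ k $ j \<bullet> v)\<^sup>2) \<le> t / (exp 1)\<^sup>2 * (norm v)\<^sup>2"
        by (simp add: sum_distrib_left power_mult_distrib mult_ac)
    qed (use entry2 l t0 in auto)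
    also have "\<dots> = exp (- l)" using t0 by simp
    finally show ?thesis .
  qed
  have rejective: "measure_pmf.prob (rejective_sampling p S) {I. bad I} \<le> 8 * poisson_mean p UNIV (\<lambda>I. of_bool (bad I))"
  proof (rule prob_rejective_sampling_le[OF p_range p_sum])
    fix I J :: "'k set" assume IJ: "I \<subseteq> J" "bad I"
    have "(\<Sum>j\<in>I. (H $ k $ j)\<^sup>2) \<le> (\<Sum>j\<in>J. (H $ k $ j)\<^sup>2)" for k
      using IJ(1) by (intro sum_mono2) auto
    then show "bad J" using IJ submatrix_large_mono unfolding bad_def by (meson order_trans)
  qed
  have "poisson_mean p UNIV (\<lambda>I. of_bool (bad I)) \<le> poisson_mean p UNIV (\<lambda>I.
      of_bool (submatrix_large H I) + (\<Sum>k\<in>UNIV. of_bool (t \<le> (\<Sum>j\<in>I. (H $ k $ j)\<^sup>2))))"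
  proof (rule poisson_mean_mono[OF p_range])
    fix I
    have "of_bool (\<exists>k. t \<le> (\<Sum>j\<in>I. (H $ k $ j)\<^sup>2)) \<le> (\<Sum>k\<in>UNIV. of_bool (t \<le> (\<Sum>j\<in>I. (H $ k $ j)\<^sup>2)) :: real)"
    proof (cases "\<exists>k. t \<le> (\<Sum>j\<in>I. (H $ k $ j)\<^sup>2)")
      case True
      then obtain k where "t \<le> (\<Sum>j\<in>I. (H $ k $ j)\<^sup>2)" by blast
      then show ?thesis
        using member_le_sum[of k UNIV "\<lambda>k. of_bool (t \<le> (\<Sum>j\<in>I. (H $ k $ j)\<^sup>2)) :: real"] by auto
    qed (auto intro!: sum_nonneg)
    then show "of_bool (bad I) \<le> of_bool (submatrix_large H I) +
        (\<Sum>k\<in>UNIV. of_bool (t \<le> (\<Sum>j\<in>I. (H $ k $ j)\<^sup>2)) :: real)"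
      unfolding bad_def by (cases "submatrix_large H I") (auto intro!: sum_nonneg)
  qed
  also have "\<dots> \<le> 12 * (real CARD('k) * exp (- l)) + (\<Sum>k\<in>(UNIV :: 'k set). exp (- l))"
    unfolding poisson_mean_add poisson_mean_sum
    by (intro add_mono sum_mono bad_row prob_submatrix_large[OF p_range l sym hollow entry1 row1 WHW'])
  \<comment> \<open>The submatrix contributes 12 and the rows 1; the factor 8 for rejective sampling
    makes this 104/218 < 1.\<close>
  also have "\<dots> = 13 / 218 * \<epsilon>" using K by (simp add: exp_l)
  finally have prob_bad: "measure_pmf.prob (rejective_sampling p S) {I. bad I} \<le> \<epsilon>"
    using rejective eps by simp
  have good: "omp_recovers \<Phi> (signal \<Phi> S c e I \<sigma>) S I"
    if I: "card I = S" "\<not> bad I" and \<sigma>: "\<And>k. k \<in> {1..S} \<Longrightarrow> \<bar>\<sigma> k\<bar> = 1" for I \<sigma>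
  proof -
    define g where "g = e I"
    have bij: "bij_betw g {1..S} I" unfolding g_def by (rule enum[OF I(1)])
    define x where "x i = (let k = the_inv_into {1..S} (g) i in c k * \<sigma> k)" for i
    have x: "x (g k) = c k * \<sigma> k" if "k \<in> {1..S}" for k
      using the_inv_into_f_f[OF bij_betw_imp_inj_on[OF bij] that] by (simp add: x_def Let_def)
    have sq: "(c k * \<sigma> k)\<^sup>2 = (c k)\<^sup>2" if "k \<in> {1..S}" for k
      using \<sigma>[OF that] by (simp add: power_mult_distrib abs_square_eq_1)
    have "signal \<Phi> S c e I \<sigma> = (\<Sum>k=1..S. x (g k) *\<^sub>R column (g k) \<Phi>)"
      unfolding signal_def by (intro sum.cong) (auto simp: x g_def[symmetric])
    also have "\<dots> = (\<Sum>i\<in>I. x i *\<^sub>R column i \<Phi>)" by (rule sum.reindex_bij_betw[OF bij])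
    finally have sig: "signal \<Phi> S c e I \<sigma> = (\<Sum>i\<in>I. x i *\<^sub>R column i \<Phi>)" .
    have "omp_recovers \<Phi> (\<Sum>i\<in>I. x i *\<^sub>R column i \<Phi>) (card I) I"
    proof (rule omp_recovers_support)
      show "\<not> submatrix_large (hollow_gram \<Phi>) I" using I(2) by (simp add: bad_def H_def)
      show "(\<Sum>j\<in>I. (hollow_gram \<Phi> $ k $ j)\<^sup>2) \<le> t" for k
        using I(2) by (auto simp: bad_def H_def not_le less_imp_le)
    next
      fix J assume J: "J \<subset> I"
      \<comment> \<open>Positions of the atoms not yet selected. The energy left on
        \<open>I - J\<close> is |c_L|_2^2 and the largest coefficient sits at \<open>g k\<close>, so
        \<open>tL\<close> is the required domination.\<close>
      define L where "L = {k \<in> {1..S}. g k \<notin> J}"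
      have bijL: "bij_betw (g) L (I - J)"
      proof (rule bij_betw_imageI)
        show "inj_on (g) L"
          by (rule inj_on_subset[OF bij_betw_imp_inj_on[OF bij]]) (auto simp: L_def)
        show "g ` L = I - J" using bij_betw_imp_surj_on[OF bij] unfolding L_def by blast
      qed
      then have img: "g ` L = I - J" by (rule bij_betw_imp_surj_on)
      then have "L \<noteq> {}" using J by blast
      then have L: "L \<in> \<L>" by (auto simp: \<L>_def L_def)
      obtain k where k: "k \<in> L" "Linf_set c L = c k" using cL(3)[OF L] by blast
      have kS: "k \<in> {1..S}" using k(1) by (simp add: L_def)
      have "(\<Sum>i\<in>I - J. (x i)\<^sup>2) = (\<Sum>k\<in>L. (x (g k))\<^sup>2)"
        by (rule sum.reindex_bij_betw[OF bijL, symmetric])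
      also have "\<dots> = (\<Sum>k\<in>L. (c k)\<^sup>2)" by (intro sum.cong) (auto simp: L_def x sq)
      also have "\<dots> = (L2_set c L)\<^sup>2" by (simp add: L2_set_def sum_nonneg)
      finally have "16 * t * (\<Sum>i\<in>I - J. (x i)\<^sup>2) \<le> (x (g k))\<^sup>2"
        using tL[OF L] k(2) by (simp add: x[OF kS] sq[OF kS])
      moreover have "g k \<in> I - J" using k(1) img by blast
      moreover have "x (g k) \<noteq> 0" using c_pos[OF kS] \<sigma>[OF kS] by (auto simp: x[OF kS])
      ultimately show "\<exists>i\<in>I - J. x i \<noteq> 0 \<and> 16 * t * (\<Sum>l\<in>I - J. (x l)\<^sup>2) \<le> (x i)\<^sup>2" by blast
    qed
    then show ?thesis by (simp only: sig I(1))
  qed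
  let ?P = "pair_pmf (rejective_sampling p S) (rademacher_signs S)"
  have card: "card I = S" if "I \<in> set_pmf (rejective_sampling p S)" for I
  proof -
    have "set_pmf (poisson_sampling p) \<inter> {I. card I = S} \<noteq> {}"
      using p_range by (intro poisson_sampling_card_possible p_sum) auto
    then show ?thesis using that by (simp add: rejective_sampling_def set_cond_pmf)
  qed
  have signs: "\<bar>\<sigma> k\<bar> = 1" if "\<sigma> \<in> set_pmf (rademacher_signs S)" "k \<in> {1..S}" for \<sigma> k
    using that by (auto simp: rademacher_signs_def set_Pi_pmf PiE_dflt_def)
  have "1 - \<epsilon> \<le> 1 - measure_pmf.prob (rejective_sampling p S) {I. bad I}" using prob_bad by simp
  also have "\<dots> = measure_pmf.prob (rejective_sampling p S) {I. \<not> bad I}"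
    using measure_pmf.prob_compl[of "{I. bad I}" "rejective_sampling p S"]
    by (simp add: Compl_eq_Diff_UNIV[symmetric] Collect_neg_eq)
  also have "\<dots> = measure_pmf.prob (map_pmf fst ?P) {I. \<not> bad I}" by (simp only: map_fst_pair_pmf)
  also have "\<dots> = measure_pmf.prob ?P (fst -` {I. \<not> bad I})" by (rule measure_map_pmf)
  \<comment> \<open>The facts |I| = S and |\<sigma> k| = 1 are available only on the support of the
    law.\<close>
  also have "\<dots> = measure_pmf.prob ?P (fst -` {I. \<not> bad I} \<inter> set_pmf ?P)"
    by (rule measure_Int_set_pmf[symmetric])
  also have "\<dots> \<le> measure_pmf.prob ?P {(I, \<sigma>). omp_recovers \<Phi> (signal \<Phi> S c e I \<sigma>) S I}"
    by (rule measure_pmf.finite_measure_mono) (auto intro!: good card signs)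
  finally show ?thesis .
qed

end
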